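(* Let $m$ be a positive integer and let $n = 4m+3$ with $n \geq 15$. Then there are at least $\left\lfloor \frac{n+9}{8} \right\rfloor$ distinct (pairwise non-isomorphic) self-dual string C-groups of rank $2m$ whose underlying group is isomorphic to the alternating group $A_n$.
   Context: A rank $r$ string group generated by involutions (sggi) is a group $\Gamma = \langle \rho_0, \ldots, \rho_{r-1}\rangle$ with a distinguished ordered tuple of generators satisfying $\rho_i^2 = 1$ for all $i$ and $(\rho_i\rho_j)^2 = 1$ whenever $|i-j| \geq 2$. An sggi is a string C-group (of rank $r$) if it satisfies the intersection condition $\langle \rho_i \mid i \in I\rangle \cap \langle \rho_j \mid j \in J\rangle = \langle \rho_k \mid k \in I\cap J\rangle$ for all $I, J \subseteq \{0,\ldots,r-1\}$. It is self-dual if there is a group automorphism of $\Gamma$ sending $\rho_i$ to $\rho_{r-1-i}$ for every $i$. Two string C-groups $\langle \rho_0,\ldots,\rho_{r-1}\rangle$ and $\langle \rho_0',\ldots,\rho_{r-1}'\rangle$ are isomorphic (not distinct) if there is a group isomorphism sending $\rho_i$ to $\rho_i'$ for each $i$. *)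

theory Defs
  imports Complex_Main "HOL-Algebra.Sym_Groups"
begin

text \<open>The distinguished ordered tuple of generators is a list
  \<open>\<rho>s = [\<rho>\<^sub>0, \<dots>, \<rho>\<^bsub>r-1\<^esub>]\<close>; the rank is its length.  The generators are
  involutions, that is, elements of order exactly 2.  Without \<open>\<rho>s ! i \<noteq> \<one>\<close>, identities could be
  inserted among the generators to raise the rank artificially.\<close>

locale sggi = group G for G (structure) +
  fixes \<rho>s :: "'a list"
  assumes generators_closed: "set \<rho>s \<subseteq> carrier G"
    and generates: "generate G (set \<rho>s) = carrier G"
    and nontrivial: "\<And>i. i < length \<rho>s \<Longrightarrow> \<rho>s ! i \<noteq> \<one>"
    and square: "\<And>i. i < length \<rho>s \<Longrightarrow> (\<rho>s ! i) [^] (2::nat) = \<one>"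
    and string: "\<And>i j. i < length \<rho>s \<Longrightarrow> j < length \<rho>s \<Longrightarrow> \<bar>int i - int j\<bar> \<ge> 2 \<Longrightarrow>
      (\<rho>s ! i \<otimes> \<rho>s ! j) [^] (2::nat) = \<one>"

locale string_C_group = sggi +
  assumes intersection_condition: "\<And>I J. I \<subseteq> {..<length \<rho>s} \<Longrightarrow> J \<subseteq> {..<length \<rho>s} \<Longrightarrow>
      generate G ((\<lambda>i. \<rho>s ! i) ` I) \<inter> generate G ((\<lambda>j. \<rho>s ! j) ` J) =
      generate G ((\<lambda>k. \<rho>s ! k) ` (I \<inter> J))"

definition self_dual :: "('a, 'b) monoid_scheme \<Rightarrow> 'a list \<Rightarrow> bool" where
  "self_dual G \<rho>s \<longleftrightarrow>
    (\<exists>\<phi> \<in> iso G G. \<forall>i < length \<rho>s. \<phi> (\<rho>s ! i) = \<rho>s ! (length \<rho>s - 1 - i))"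

definition isomorphic_sggi ::
    "('a, 'b) monoid_scheme \<times> 'a list \<Rightarrow> ('c, 'd) monoid_scheme \<times> 'c list \<Rightarrow> bool" where
  "isomorphic_sggi = (\<lambda>(G, \<rho>s) (H, \<sigma>s).
    length \<rho>s = length \<sigma>s \<and>
    (\<exists>\<phi> \<in> iso G H. \<forall>i < length \<rho>s. \<phi> (\<rho>s ! i) = \<sigma>s ! i))"

end

theory Submission
  imports Defs
begin

text \<open>The points \<open>1, \<dots>, 4m+3\<close> carry the involution \<open>\<delta>(y) = 4m+4-y\<close>, whose only fixed point is
  \<open>c = 2m+2\<close>.  Take even involutions \<open>\<rho>\<^sub>0, \<dots>, \<rho>\<^bsub>m-1\<^esub>\<close> of the left half \<open>{1, \<dots>, 2m+2}\<close> such that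
  only the last one moves \<open>c\<close>, and complete them by \<open>\<rho>\<^bsub>2m-1-i\<^esub> = \<delta> \<rho>\<^sub>i \<delta>\<close>.  The two halves share
  only \<open>c\<close>, so \<open>(\<rho>\<^bsub>m-1\<^esub> \<rho>\<^sub>m)\<^sup>2\<close> is a 3-cycle; hence every \<open>\<langle>\<rho>\<^sub>i, \<dots>, \<rho>\<^sub>j\<rangle>\<close> with \<open>i < m \<le> j\<close> contains the
  alternating group on the orbit of \<open>c\<close>, and away from that orbit its elements agree with
  elements of the two halves.  This reduces the intersection condition to the left half.

  The left half consists of two rows of \<open>m+1\<close> points.  Its generators act as the Coxeter
  generators of the symmetric group on the columns, except that for a chosen even \<open>k\<close> with
  \<open>2 \<le> k < m\<close> the generator \<open>\<rho>\<^sub>k\<close> also swaps the rows in the first \<open>k\<close> columns; two further choices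
  come from modifying \<open>\<rho>\<^sub>0\<close> and \<open>\<rho>\<^sub>2\<close>.  The orders of the products \<open>\<rho>\<^sub>i \<rho>\<^bsub>i+1\<^esub>\<close> tell all these apart.\<close>

section \<open>The intersection condition from intervals\<close>

text \<open>Two rows are used because a swap of two columns is then a product of two transpositions,
  hence even. Plain column swaps never change the row, so some generator must also swap rows. It has
  to do so in an even number of columns, to stay even, and in an initial block of columns, to
  commute with the generators at distance at least two; hence the even \<open>k\<close>. The two
  corner systems move the row swap to the first generator instead. The delicate point is the middle.
  For an interval that crosses it, only parity and the behaviour off the orbit of \<open>c\<close>
  remain to be checked. When one of the two intervals compared stops exactly there, their common
  part has no generator from the right half, so there is no 3-cycle to use, and the left half must
  satisfy the extra condition \<open>detached\<close>. Within a rung system the column permutations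
  cause no difficulty; what matters is which row swaps over the identity an interval contains. There
  are \<open>(m + 1) div 2 - 1\<close> even values with \<open>2 \<le> k < m\<close>. With the two
  corner systems this makes \<open>(m + 3) div 2\<close>, which is the claimed bound for
  \<open>n = 4 * m + 3\<close>.\<close>

inductive_set gen :: "('a \<Rightarrow> 'a) set \<Rightarrow> ('a \<Rightarrow> 'a) set" for S where
  gen_id: "id \<in> gen S"
| gen_step: "s \<in> S \<Longrightarrow> g \<in> gen S \<Longrightarrow> s \<circ> g \<in> gen S"

lemma gen_base: "s \<in> S \<Longrightarrow> s \<in> gen S"
  using gen_step[OF _ gen_id] by fastforce

lemma gen_comp: "g \<in> gen S \<Longrightarrow> h \<in> gen S \<Longrightarrow> g \<circ> h \<in> gen S"
  by (induction rule: gen.induct) (auto simp: comp_assoc intro: gen_step)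

lemma gen_minimal:
  assumes "S \<subseteq> gen T" "g \<in> gen S"
  shows "g \<in> gen T"
  using assms(2) by induction (use assms(1) in \<open>blast intro: gen_id gen_comp\<close>)+

lemma gen_mono: "S \<subseteq> T \<Longrightarrow> gen S \<subseteq> gen T"
  using gen_minimal gen_base by (metis subset_iff)

lemma gen_empty [simp]: "gen {} = {id}"
  by (auto elim: gen.cases intro: gen_id)

text \<open>\<open>gen\<close> is closed under composition only. Reversing a word in involutions
  inverts it, so for such generators this monoid is already the generated group, while inductions
  keep a single step case.\<close>

lemma gen_inverse:
  assumes "\<And>s. s \<in> S \<Longrightarrow> s \<circ> s = id" "g \<in> gen S"
  shows "bij g \<and> inv' g \<in> gen S"
  using assms(2)
proof induction
  case gen_id
  show ?case using gen.gen_id by (metis bij_id inv_id)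
next
  case (gen_step s g)
  have s: "bij s" "inv' s = s"
    using assms(1)[OF gen_step(1)] by (auto intro: o_bij inv_unique_comp)
  then have "inv' (s \<circ> g) = inv' g \<circ> s"
    using gen_step by (simp add: o_inv_distrib)
  then show ?case
    using s gen_step gen_comp gen_base by (metis bij_comp)
qed

lemma bij_cancel:
  assumes "bij f"
  shows "inv' f \<circ> f = id" "f \<circ> inv' f = id"
    "inv' f \<circ> (f \<circ> g) = g" "f \<circ> (inv' f \<circ> h) = h"
  using assms by (simp_all add: fun_eq_iff bij_is_inj bij_is_surj surj_f_inv_f)

lemma gen_image_conj:
  assumes "d \<circ> d = id" "g \<in> gen S"
  shows "d \<circ> g \<circ> d \<in> gen ((\<lambda>s. d \<circ> s \<circ> d) ` S)"
  using assms(2)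
proof induction
  case gen_id
  show ?case using assms(1) gen.gen_id by (metis comp_id)
next
  case (gen_step s g)
  have "d \<circ> (s \<circ> g) \<circ> d = (d \<circ> s \<circ> d) \<circ> (d \<circ> g \<circ> d)"
    using assms(1) by (metis comp_assoc comp_id)
  then show ?case using gen_step by (metis gen.gen_step image_eqI)
qed

text \<open>The axioms range over all natural numbers, so spans need no bound on their indices; a
  finite sequence is padded with identities.\<close>

locale commuting_involutions =
  fixes \<rho> :: "nat \<Rightarrow> 'a \<Rightarrow> 'a"
  assumes invol: "\<rho> i \<circ> \<rho> i = id"
    and comm: "i + 2 \<le> j \<Longrightarrow> \<rho> i \<circ> \<rho> j = \<rho> j \<circ> \<rho> i"
begin

abbreviation span :: "nat set \<Rightarrow> ('a \<Rightarrow> 'a) set"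
  where "span I \<equiv> gen (\<rho> ` I)"

lemma span_bij: "g \<in> span I \<Longrightarrow> bij g"
  and span_inv: "g \<in> span I \<Longrightarrow> inv' g \<in> span I"
  using gen_inverse[of "\<rho> ` I" g] invol by auto

lemma span_mono: "I \<subseteq> J \<Longrightarrow> span I \<subseteq> span J"
  by (intro gen_mono image_mono)

lemma span_monoD: "g \<in> span I \<Longrightarrow> I \<subseteq> J \<Longrightarrow> g \<in> span J"
  using span_mono by blast

lemma span_commute:
  assumes "\<And>i j. i \<in> I \<Longrightarrow> j \<in> J \<Longrightarrow> i + 2 \<le> j" "g \<in> span I" "h \<in> span J"
  shows "g \<circ> h = h \<circ> g"
  using assms(2)
proof induction
  case gen_id
  show ?case by simp
next
  case (gen_step s g)
  then obtain i where i: "i \<in> I" "s = \<rho> i" by blast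
  have "s \<circ> h = h \<circ> s"
    using assms(3)
  proof induction
    case (gen_step t h)
    then obtain j where "j \<in> J" "t = \<rho> j" by blast
    then have "s \<circ> t = t \<circ> s"
      using i assms(1)[of i j] comm[of i j] by metis
    then show ?case using gen_step by (metis comp_assoc)
  qed simp
  then show ?case using gen_step by (metis comp_assoc)
qed

lemma span_union:
  assumes "\<And>i j. i \<in> I \<Longrightarrow> j \<in> J \<Longrightarrow> i + 2 \<le> j" "g \<in> span (I \<union> J)"
  obtains a b where "a \<in> span I" "b \<in> span J" "g = a \<circ> b"
proof -
  have "\<exists>a \<in> span I. \<exists>b \<in> span J. g = a \<circ> b"
    using assms(2)
  proof induction
    case gen_id
    show ?case using gen.gen_id by (metis comp_id)
  next
    case (gen_step s g)
    then obtain a b where ab: "a \<in> span I" "b \<in> span J" "g = a \<circ> b" by blast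
    from gen_step consider "s \<in> \<rho> ` I" | "s \<in> \<rho> ` J" by blast
    then show ?case
    proof cases
      case 1
      then show ?thesis using ab by (metis gen.gen_step comp_assoc)
    next
      case 2
      then have "a \<circ> s = s \<circ> a"
        using span_commute[OF assms(1) ab(1) gen_base] by blast
      then show ?thesis using ab 2 by (metis gen.gen_step comp_assoc)
    qed
  qed
  then show ?thesis using that by blast
qed

text \<open>A missing index cuts the string in two: generators on different sides of
  \<open>i\<close> commute, so every word can be sorted by side.\<close>

lemma span_disjoint_split:
  assumes "I \<subseteq> {lo..<hi}" "i \<notin> I" "g \<in> span I"
  obtains a b where "a \<in> span (I \<inter> {lo..<i})" "b \<in> span (I \<inter> {Suc i..<hi})" "g = a \<circ> b"
proof (rule span_union[of "I \<inter> {lo..<i}" "I \<inter> {Suc i..<hi}" g])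
  have "x \<in> {lo..<i} \<union> {Suc i..<hi}" if "x \<in> I" for x
  proof -
    have "x \<noteq> i" "x \<in> {lo..<hi}" using that assms by auto
    then show ?thesis by auto
  qed
  then have "I = I \<inter> {lo..<i} \<union> I \<inter> {Suc i..<hi}" by blast
  then show "g \<in> span (I \<inter> {lo..<i} \<union> I \<inter> {Suc i..<hi})" using assms(3) by simp
qed (use that in auto)

end

text \<open>It suffices to compare each interval of generators with its shift by one
  (cf. McMullen and Schulte, Proposition 2E16).\<close>

locale interval_intersection = commuting_involutions +
  fixes r :: nat
  assumes interval_step: "i < j \<Longrightarrow> j < r \<Longrightarrow>
    span {i..<j} \<inter> span {Suc i..<Suc j} \<subseteq> span {Suc i..<j}"
begin

text \<open>Both intervals are enlarged to \<open>{a..<d - 1}\<close> and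
  \<open>{Suc a..<d}\<close>, which differ by a shift; \<open>interval_step\<close> then cuts one
  generator off each end, and the shortened interval is compared with the two original ones in turn.
  For \<open>b \<le> c\<close> the result says that \<open>g\<close> is the identity.\<close>

lemma interval_inter:
  assumes "a \<le> c" "b \<le> d" "d \<le> r" "g \<in> span {a..<b}" "g \<in> span {c..<d}"
  shows "g \<in> span {c..<b}"
  using assms
proof (induction "(c - a) + (d - b)" arbitrary: a b c d rule: less_induct)
  case less
  show ?case
  proof (cases "a = c \<or> b = d \<or> c \<ge> d")
    case True
    then show ?thesis using less.prems by (auto intro: gen_id)
  next
    case False
    then have *: "a < c" "b < d" "c < d" using less.prems by auto
    then obtain e where e: "d = Suc e" by (cases d) auto
    have "g \<in> span {a..<e}" "g \<in> span {Suc a..<Suc e}"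
      using less.prems * e span_mono[of "{a..<b}" "{a..<e}"]
        span_mono[of "{c..<d}" "{Suc a..<Suc e}"] by auto
    then have "g \<in> span {Suc a..<e}"
      using interval_step[of a e] * e less.prems(3) by auto
    then have "g \<in> span {Suc a..<b}"
      using less.hyps[of "Suc a" a e b] less.prems * e by simp
    then show ?thesis
      using less.hyps[of c "Suc a" d b] less.prems * by simp
  qed
qed

text \<open>If \<open>i \<notin> I\<close> and \<open>j \<notin> J\<close> with \<open>i \<le> j\<close>, an element of both groups factors as \<open>ab = cd\<close> around
  \<open>i\<close> and \<open>j\<close>; then \<open>u = c\<^sup>-\<^sup>1 a = d b\<^sup>-\<^sup>1\<close> lies strictly between \<open>i\<close> and \<open>j\<close>, and induction applies
  to \<open>a\<close>, \<open>u\<close> and \<open>d\<close> separately.\<close>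

lemma span_inter_aux:
  assumes hi: "hi \<le> r"
    and IH: "\<And>lo' hi' I J g. lo \<le> lo' \<Longrightarrow> hi' \<le> hi \<Longrightarrow> hi' - lo' < hi - lo \<Longrightarrow>
      I \<subseteq> {lo'..<hi'} \<Longrightarrow> J \<subseteq> {lo'..<hi'} \<Longrightarrow> g \<in> span I \<Longrightarrow> g \<in> span J \<Longrightarrow> g \<in> span (I \<inter> J)"
    and I: "I \<subseteq> {lo..<hi}" "i \<in> {lo..<hi}" "i \<notin> I"
    and J: "J \<subseteq> {lo..<hi}" "j \<in> {lo..<hi}" "j \<notin> J"
    and ij: "i \<le> j" and g: "g \<in> span I" "g \<in> span J"
  shows "g \<in> span (I \<inter> J)"
proof -
  let ?M = "{Suc i..<j}"
  obtain a b where a: "a \<in> span (I \<inter> {lo..<i})" and b: "b \<in> span (I \<inter> {Suc i..<hi})"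
    and gab: "g = a \<circ> b"
    using span_disjoint_split[OF I(1,3) g(1)] .
  obtain c d where c: "c \<in> span (J \<inter> {lo..<j})" and d: "d \<in> span (J \<inter> {Suc j..<hi})"
    and gcd: "g = c \<circ> d"
    using span_disjoint_split[OF J(1,3) g(2)] .
  define u where "u = inv' c \<circ> a"
  have bij: "bij a" "bij b" "bij c" "bij d"
    using a b c d span_bij by auto
  have cu: "a = c \<circ> u"
    unfolding u_def using bij by (simp add: bij_cancel)
  have ub: "d = u \<circ> b"
    using gab gcd bij by (metis u_def comp_assoc bij_cancel(3))
  have "u \<in> span {lo..<j}"
    unfolding u_def
    by (rule gen_comp[OF span_monoD[OF span_inv[OF c]] span_monoD[OF a]]) (use ij in auto)
  moreover have "u = d \<circ> inv' b"
    using ub bij by (simp add: comp_assoc bij_cancel)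
  then have "u \<in> span {Suc i..<hi}"
    using gen_comp[OF span_monoD[OF d] span_monoD[OF span_inv[OF b]], of "{Suc i..<hi}"] ij
    by fastforce
  ultimately have u: "u \<in> span ?M"
    using interval_inter[of lo "Suc i" j hi u] I(2) J(2) hi by auto
  have bij_u: "bij u" using u span_bij by blast
  have iu: "inv' u \<in> span ?M" using u span_inv by blast
  have triv: "span ?M \<inter> span {Suc j..<hi} \<subseteq> {id}" "span {lo..<i} \<inter> span ?M \<subseteq> {id}"
    using interval_inter[of "Suc i" "Suc j" j hi] interval_inter[of lo "Suc i" i j] I(2) J(2) hi ij
    by auto

  \<comment> \<open>\<open>b\<close> combines \<open>u\<close> and \<open>d\<close>: it lies over
    \<open>I\<close> and also over \<open>?M\<close> together with part of \<open>J\<close>, inside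
    a shorter interval. The induction hypothesis splits it as \<open>u1 \<circ> d1\<close>, and by
    \<open>triv\<close> this can only be the splitting into the inverse of \<open>u\<close> and
    \<open>d\<close>. So both have indices in \<open>I\<close>.\<close>
  have "b = inv' u \<circ> d"
    using ub bij_u by (simp add: bij_cancel)
  then have "b \<in> span (?M \<union> (J \<inter> {Suc j..<hi}))"
    using gen_comp[OF span_monoD[OF iu] span_monoD[OF d], of "?M \<union> (J \<inter> {Suc j..<hi})"]
    by auto
  then have "b \<in> span ((I \<inter> {Suc i..<hi}) \<inter> (?M \<union> (J \<inter> {Suc j..<hi})))"
    by (intro IH[of "Suc i" hi, OF _ _ _ _ _ b]) (use I(2) J(2) ij in auto)
  then have "b \<in> span ((I \<inter> ?M) \<union> (I \<inter> J \<inter> {Suc j..<hi}))"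
    by (rule span_monoD) auto
  then obtain u1 d1 where u1: "u1 \<in> span (I \<inter> ?M)" and d1: "d1 \<in> span (I \<inter> J \<inter> {Suc j..<hi})"
    and b1: "b = u1 \<circ> d1"
    by (rule span_union[rotated]) auto
  have bij1: "bij u1" "bij d1" using u1 d1 span_bij by auto
  have e1: "u \<circ> u1 = d \<circ> inv' d1"
    using ub b1 bij1 by (simp add: comp_assoc bij_cancel)
  have "u \<circ> u1 \<in> span ?M"
    by (rule gen_comp[OF u span_monoD[OF u1]]) auto
  moreover have "d \<circ> inv' d1 \<in> span {Suc j..<hi}"
    by (rule gen_comp[OF span_monoD[OF d] span_monoD[OF span_inv[OF d1]]]) auto
  ultimately have "u \<circ> u1 = id" "d \<circ> inv' d1 = id"
    using triv(1) e1 by auto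
  then have "u = inv' u1" "d = d1"
    using bij1 by (metis bij_cancel(2) comp_assoc comp_id id_comp)
      (metis \<open>d \<circ> inv' d1 = id\<close> bij1(2) bij_cancel(1) comp_assoc comp_id id_comp)
  then have uI: "u \<in> span (I \<inter> ?M)" and dI: "d \<in> span (I \<inter> J \<inter> {Suc j..<hi})"
    using u1 d1 span_inv by auto

  \<comment> \<open>The mirror image of the argument for \<open>b\<close>: it places
    \<open>u\<close> over \<open>J\<close> and leaves a remaining factor \<open>a1\<close> over
    \<open>I \<inter> J\<close>.\<close>
  have "c = a \<circ> inv' u"
    using cu bij_u by (simp add: comp_assoc bij_cancel)
  then have "c \<in> span ((I \<inter> {lo..<i}) \<union> ?M)"
    using gen_comp[OF span_monoD[OF a] span_monoD[OF iu], of "(I \<inter> {lo..<i}) \<union> ?M"]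
    by auto
  then have "c \<in> span ((J \<inter> {lo..<j}) \<inter> ((I \<inter> {lo..<i}) \<union> ?M))"
    by (intro IH[of lo j, OF _ _ _ _ _ c]) (use I(2) J(2) ij in auto)
  then have "c \<in> span ((I \<inter> J \<inter> {lo..<i}) \<union> (J \<inter> ?M))"
    by (rule span_monoD) auto
  then obtain a1 u2 where a1: "a1 \<in> span (I \<inter> J \<inter> {lo..<i})" and u2: "u2 \<in> span (J \<inter> ?M)"
    and c1: "c = a1 \<circ> u2"
    by (rule span_union[rotated]) auto
  have bij2: "bij a1" "bij u2" using a1 u2 span_bij by auto
  have e2: "inv' a1 \<circ> a = u2 \<circ> u"
    using cu c1 bij2 by (simp add: comp_assoc bij_cancel)
  have "u2 \<circ> u \<in> span ?M"
    by (rule gen_comp[OF span_monoD[OF u2] u]) auto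
  moreover have "inv' a1 \<circ> a \<in> span {lo..<i}"
    by (rule gen_comp[OF span_monoD[OF span_inv[OF a1]] span_monoD[OF a]]) auto
  ultimately have "u2 \<circ> u = id"
    using triv(2) e2 by auto
  then have "u = inv' u2"
    using bij2 by (metis bij_cancel(3) comp_id)
  then have uJ: "u \<in> span (J \<inter> ?M)"
    using u2 span_inv by auto

  have "u \<in> span ((I \<inter> ?M) \<inter> (J \<inter> ?M))"
    by (intro IH[of "Suc i" j, OF _ _ _ _ _ uI uJ]) (use I(2) J(2) ij in auto)
  then have "inv' u \<in> span (I \<inter> J)"
    using span_monoD[OF span_inv, of u _ "I \<inter> J"] by auto
  moreover have "u2 = inv' u"
    using \<open>u2 \<circ> u = id\<close> bij_u by (metis bij_cancel(2) comp_assoc comp_id id_comp)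
  moreover have "a1 \<in> span (I \<inter> J)" "d \<in> span (I \<inter> J)"
    using span_monoD[OF a1] span_monoD[OF dI] by auto
  ultimately show ?thesis
    unfolding gcd c1 by (auto intro!: gen_comp)
qed

theorem span_inter:
  assumes "I \<subseteq> {..<r}" "J \<subseteq> {..<r}"
  shows "span I \<inter> span J = span (I \<inter> J)"
proof
  have "g \<in> span (I \<inter> J)"
    if "hi \<le> r" "I \<subseteq> {lo..<hi}" "J \<subseteq> {lo..<hi}" "g \<in> span I" "g \<in> span J" for lo hi I J g
    using that
  proof (induction "hi - lo" arbitrary: lo hi I J g rule: less_induct)
    case less
    note IH = less.hyps and prems = less.prems
    show ?case
    proof (cases "I = {lo..<hi} \<or> J = {lo..<hi}")
      case True
      then show ?thesis using prems by (auto simp: Int_absorb1 Int_absorb2)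
    next
      case False
      then obtain i j where i: "i \<in> {lo..<hi}" "i \<notin> I" and j: "j \<in> {lo..<hi}" "j \<notin> J"
        using prems by blast
      have IH': "\<And>lo' hi' I J g. lo \<le> lo' \<Longrightarrow> hi' \<le> hi \<Longrightarrow> hi' - lo' < hi - lo \<Longrightarrow>
          I \<subseteq> {lo'..<hi'} \<Longrightarrow> J \<subseteq> {lo'..<hi'} \<Longrightarrow> g \<in> span I \<Longrightarrow> g \<in> span J \<Longrightarrow>
          g \<in> span (I \<inter> J)"
        using IH prems(1) by (meson le_trans)
      show ?thesis
      proof (cases "i \<le> j")
        case True
        then show ?thesis
          by (intro span_inter_aux[OF prems(1) IH' prems(2) i prems(3) j _ prems(4,5)]) auto
      next
        case False
        then show ?thesis
          by (subst Int_commute, intro span_inter_aux[OF prems(1) IH' prems(3) j prems(2) i _ prems(5,4)])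
            auto
      qed
    qed
  qed
  from this[of r _ 0] show "span I \<inter> span J \<subseteq> span (I \<inter> J)"
    using assms by (metis IntE subsetI atLeast0LessThan order_refl)
  show "span (I \<inter> J) \<subseteq> span I \<inter> span J"
    using span_mono by (meson Int_lower1 Int_lower2 le_inf_iff)
qed

end

section \<open>Groups glued along a point\<close>

definition cyc :: "'a \<Rightarrow> 'a \<Rightarrow> 'a \<Rightarrow> 'a \<Rightarrow> 'a"
  where "cyc x y z = transpose x y \<circ> transpose y z"

lemma cyc_inverse: "cyc x y z \<circ> cyc z y x = id"
  by (auto simp: cyc_def fun_eq_iff transpose_commute)

lemma cyc_apply:
  assumes "distinct [x, y, z]"
  shows "cyc x y z x = y" "cyc x y z y = z" "cyc x y z z = x"
    "w \<noteq> x \<Longrightarrow> w \<noteq> y \<Longrightarrow> w \<noteq> z \<Longrightarrow> cyc x y z w = w"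
  using assms by (auto simp: cyc_def)

lemma cyc_rotate: "distinct [x, y, z] \<Longrightarrow> cyc y z x = cyc x y z"
  by (auto simp: cyc_def fun_eq_iff transpose_def)

lemma even_cyc: "distinct [x, y, z] \<Longrightarrow> evenperm (cyc x y z)"
  by (auto simp: cyc_def evenperm_comp permutation_swap_id evenperm_swap)

lemma permutation_cyc: "permutation (cyc x y z)"
  by (simp add: cyc_def permutation_compose permutation_swap_id)

lemma cyc_permutes: "{x, y, z} \<subseteq> S \<Longrightarrow> cyc x y z permutes S"
  by (auto simp: cyc_def intro!: permutes_compose permutes_swap_id)

lemma bij_imp_permutes_ext: "bij p \<Longrightarrow> (\<And>x. x \<notin> S \<Longrightarrow> p x = x) \<Longrightarrow> p permutes S"
  by (simp add: permutes_def bij_iff)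

locale perm_group =
  fixes G :: "('a \<Rightarrow> 'a) set"
  assumes id_mem: "id \<in> G"
    and comp_mem: "g \<in> G \<Longrightarrow> h \<in> G \<Longrightarrow> g \<circ> h \<in> G"
    and inv_mem: "g \<in> G \<Longrightarrow> inv' g \<in> G"
    and bij_mem: "g \<in> G \<Longrightarrow> bij g"
begin

text \<open>If \<open>p\<close> maps \<open>x\<close> to \<open>y\<close>, the cycle taking
  \<open>y\<close> back to \<open>x\<close>, composed with \<open>p\<close>, fixes \<open>x\<close>.
  Choosing the third point among those moved by \<open>p\<close> ensures that no new point is moved,
  so the support shrinks.\<close>

lemma even_mem_of_cycles:
  assumes "finite S" "p permutes S" "evenperm p"
    and cyc: "\<And>x y z. distinct [x, y, z] \<Longrightarrow> {x, y, z} \<subseteq> S \<Longrightarrow> cyc x y z \<in> G"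
  shows "p \<in> G"
  using assms(2,3)
proof (induction "card {x. p x \<noteq> x}" arbitrary: p rule: less_induct)
  case less
  have fin: "finite {x. p x \<noteq> x}"
    using less.prems(1) assms(1) by (metis permutes_imp_permutation permutation)
  have perm: "permutation p"
    using less.prems(1) assms(1) permutes_imp_permutation by blast
  show ?case
  proof (cases "p = id")
    case True
    then show ?thesis by (simp add: id_mem)
  next
    case False
    then obtain x where x: "p x \<noteq> x" by (auto simp: fun_eq_iff)
    define y where "y = p x"
    have py: "p y \<noteq> y"
      using x less.prems(1) unfolding y_def by (metis permutes_def)
    \<comment> \<open>Without a third moved point \<open>p\<close> would be a transposition, which
      is odd.\<close>
    obtain z where z: "p z \<noteq> z" "z \<noteq> x" "z \<noteq> y"
    proof (rule ccontr)
      assume "\<not> thesis"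
      then have "\<And>z. z \<notin> {x, y} \<Longrightarrow> p z = z" using that by auto
      then have "p permutes {x, y}"
        using less.prems(1) by (auto simp: permutes_def)
      then have "p = transpose x y" using False by (simp add: permutes_doubleton_iff)
      then have "evenperm (transpose x y)" using less.prems(2) by metis
      then show False using x by (simp add: evenperm_swap y_def)
    qed
    have dist: "distinct [x, y, z]" "distinct [z, y, x]" using x z by (auto simp: y_def)
    have sub: "{x, y, z} \<subseteq> S" "{z, y, x} \<subseteq> S"
      using less.prems(1) x py z by (auto simp: permutes_def)
    define q where "q = cyc z y x \<circ> p"
    have p: "p = cyc x y z \<circ> q"
      unfolding q_def by (simp add: o_assoc cyc_inverse)
    have qx: "q x = x" using cyc_apply[OF dist(2)] by (simp add: q_def y_def)
    have "q w = w" if "p w = w" for w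
      using that x py z cyc_apply(4)[OF dist(2), of w] by (auto simp: q_def)
    then have "{w. q w \<noteq> w} \<subseteq> {w. p w \<noteq> w} - {x}"
      using qx by auto
    then have "card {w. q w \<noteq> w} < card {w. p w \<noteq> w}"
      using fin x by (intro psubset_card_mono) auto
    moreover have "q permutes S"
      unfolding q_def by (intro permutes_compose less.prems cyc_permutes sub)
    moreover have "evenperm q"
      unfolding q_def evenperm_comp[OF permutation_cyc perm] using even_cyc[OF dist(2)] less.prems(2)
      by simp
    ultimately have "q \<in> G" using less.hyps by blast
    then show ?thesis
      unfolding p using cyc[OF dist(1) sub(1)] comp_mem by blast
  qed
qed

lemma cyc_conj:
  assumes "g \<in> G" "cyc x y z \<in> G"
  shows "cyc (g x) (g y) (g z) \<in> G"
proof -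
  have b: "bij g" using assms bij_mem by blast
  have t: "transpose (g u) (g v) = g \<circ> transpose u v \<circ> inv' g" for u v
  proof -
    have "transpose (g u) (g v) \<circ> g = g \<circ> transpose u v"
      using transpose_comp_eq[OF b, of "g u" "g v"] b by (simp add: bij_is_inj)
    then have "transpose (g u) (g v) \<circ> (g \<circ> inv' g) = g \<circ> transpose u v \<circ> inv' g"
      by (simp add: o_assoc)
    then show ?thesis using b by (simp add: bij_cancel)
  qed
  have "cyc (g x) (g y) (g z) = g \<circ> cyc x y z \<circ> inv' g"
    unfolding cyc_def t using b by (simp add: comp_assoc bij_cancel)
  then show ?thesis using assms comp_mem inv_mem by metis
qed

lemma cyc_reverse:
  assumes "cyc x y z \<in> G"
  shows "cyc z y x \<in> G"
proof -
  have "inv' (cyc x y z) = cyc z y x"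
    by (rule inv_unique_comp) (simp_all add: cyc_inverse)
  then show ?thesis using assms inv_mem by metis
qed

text \<open>Being the first two points of a 3-cycle of the group is an equivalence relation, and each of
  its classes supports all 3-cycles on it.\<close>

definition linked :: "'a \<Rightarrow> 'a \<Rightarrow> bool"
  where "linked x y \<longleftrightarrow> x = y \<or> (\<exists>z. distinct [x, y, z] \<and> cyc x y z \<in> G)"

lemma linked_sym: "linked x y \<Longrightarrow> linked y x"
  unfolding linked_def using cyc_reverse cyc_rotate
  by (metis distinct_length_2_or_more)

lemma linked_trans:
  assumes "linked x y" "linked y w"
  shows "linked x w"
proof (cases "x = y \<or> y = w \<or> x = w")
  case True
  then show ?thesis using assms by (auto simp: linked_def)
next
  case False
  then obtain z v where z: "distinct [x, y, z]" "cyc x y z \<in> G"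
    and v: "distinct [y, w, v]" "cyc y w v \<in> G"
    using assms by (auto simp: linked_def)
  show ?thesis
  proof (cases "v = x")
    case True
    then show ?thesis using v cyc_reverse False unfolding linked_def by fastforce
  next
    case 2: False
    let ?g = "cyc y w v"
    have "?g x = x" "?g y = w" using cyc_apply[OF v(1)] False 2 by auto
    moreover have "distinct [?g x, ?g y, ?g z]"
      using z(1) bij_mem[OF v(2)] by (simp add: bij_is_inj inj_eq)
    moreover have "cyc (?g x) (?g y) (?g z) \<in> G" using cyc_conj[OF v(2) z(2)] .
    ultimately show ?thesis unfolding linked_def by metis
  qed
qed

text \<open>The unwanted third points \<open>u\<close> and \<open>v\<close> are removed by
  conjugation. If they coincide, conjugating \<open>(x z v)\<close> by \<open>(x y v)\<close> gives
  \<open>(y z x)\<close>. If all points are different, conjugating by \<open>(x y u)\<close> gives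
  \<open>(y z v)\<close>, and conjugating that by \<open>(v z x)\<close> gives
  \<open>(y x z)\<close>, the inverse of the desired cycle.\<close>

lemma cyc_mem_of_linked:
  assumes "linked x y" "linked x z" and d: "distinct [x, y, z]"
  shows "cyc x y z \<in> G"
proof -
  obtain u v where u: "distinct [x, y, u]" "cyc x y u \<in> G" and v: "distinct [x, z, v]" "cyc x z v \<in> G"
    using assms by (auto simp: linked_def)
  consider "u = z" | "v = y" | "u = v" "v \<noteq> y" | "u \<noteq> z" "v \<noteq> y" "u \<noteq> v" by blast
  then show ?thesis
  proof cases
    case 1
    then show ?thesis using u by simp
  next
    case 2
    then show ?thesis using cyc_reverse[OF v(2)] cyc_rotate[OF d] by simp
  next
    case 3
    then have "cyc y z x \<in> G"
      using cyc_conj[OF u(2) v(2)] cyc_apply[OF u(1)] u v d by auto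
    then show ?thesis using cyc_rotate[OF d] by simp
  next
    case 4
    then have yzv: "cyc y z v \<in> G"
      using cyc_conj[OF u(2) v(2)] cyc_apply[OF u(1)] u v d by auto
    have vzx: "distinct [v, z, x]" using v by auto
    have "cyc y x z \<in> G"
      using cyc_conj[OF cyc_reverse[OF v(2)] yzv] cyc_apply[OF vzx] 4 d by auto
    then have "cyc z x y \<in> G" using cyc_reverse by blast
    then show ?thesis using cyc_rotate[of z x y] d by auto
  qed
qed

end

section \<open>Two permutation groups whose domains share one point\<close>

locale wedge =
  fixes A B :: "('a \<Rightarrow> 'a) set" and X Y :: "'a set" and c :: 'a
  assumes wedge_invol: "s \<in> A \<union> B \<Longrightarrow> s \<circ> s = id"
    and wedge_even: "s \<in> A \<union> B \<Longrightarrow> evenperm s"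
    and wedge_left: "s \<in> A \<Longrightarrow> s permutes X"
    and wedge_right: "t \<in> B \<Longrightarrow> t permutes Y"
    and wedge_inter: "X \<inter> Y = {c}"
    and wedge_finite: "finite X" "finite Y"
begin

lemma wedge_swap: "wedge B A Y X c"
  using wedge_axioms unfolding wedge_def by (simp add: Un_commute Int_commute)

abbreviation left_orbit where "left_orbit \<equiv> (\<lambda>g. g c) ` gen A"
abbreviation right_orbit where "right_orbit \<equiv> (\<lambda>g. g c) ` gen B"

lemma left_permutes: "g \<in> gen A \<Longrightarrow> g permutes X"
  by (induction rule: gen.induct) (blast intro: permutes_id permutes_compose wedge_left)+

lemma right_permutes: "g \<in> gen B \<Longrightarrow> g permutes Y"
  using wedge.left_permutes[OF wedge_swap] .

lemma left_permutation: "g \<in> gen A \<Longrightarrow> permutation g"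
  using left_permutes permutes_imp_permutation wedge_finite by blast

lemma left_even: "g \<in> gen A \<Longrightarrow> evenperm g"
proof (induction rule: gen.induct)
  case (gen_step s g)
  then show ?case
    using wedge_even left_permutation gen_base by (metis Un_iff evenperm_comp)
qed simp

lemma c_in: "c \<in> X" "c \<in> Y" "c \<in> left_orbit"
  using wedge_inter gen_id by (auto intro!: image_eqI[of _ _ id])

lemma left_orbit_closed:
  assumes "g \<in> gen A" shows "g x \<in> left_orbit \<longleftrightarrow> x \<in> left_orbit"
proof
  have g: "bij g" "inv' g \<in> gen A" using gen_inverse[OF _ assms] wedge_invol by auto
  { assume "g x \<in> left_orbit"
    then obtain h where h: "h \<in> gen A" "g x = h c" by auto
    then have "x = (inv' g \<circ> h) c"
      using g by (metis bij_inv_eq_iff comp_apply)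
    then show "x \<in> left_orbit" using gen_comp[OF g(2) h(1)] by blast }
  assume "x \<in> left_orbit"
  then obtain h where "h \<in> gen A" "x = h c" by auto
  then show "g x \<in> left_orbit" using gen_comp[OF assms] by (auto intro!: image_eqI[of _ _ "g \<circ> h"])
qed

lemma left_orbit_subset: "left_orbit \<subseteq> X"
proof
  fix x assume "x \<in> left_orbit"
  then obtain g where "g \<in> gen A" "x = g c" by blast
  then show "x \<in> X" using left_permutes[of g] c_in(1) by (simp add: permutes_in_image)
qed

text \<open>A point of \<open>X\<close> off the orbit of \<open>c\<close> can never be carried to
  \<open>c\<close> by \<open>A\<close>, so it never enters \<open>Y\<close> and every letter from
  \<open>B\<close> fixes it. Deleting these letters from a word for \<open>g\<close> yields
  \<open>l\<close>.\<close>

lemma wedge_agree: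
  assumes "g \<in> gen (A \<union> B)"
  shows "\<exists>l \<in> gen A. \<forall>x \<in> X - left_orbit. g x = l x"
  using assms
proof induction
  case gen_id
  show ?case using gen.gen_id by blast
next
  case (gen_step s g)
  then obtain l where l: "l \<in> gen A" "\<forall>x \<in> X - left_orbit. g x = l x" by blast
  from gen_step consider "s \<in> A" | "s \<in> B" by blast
  then show ?case
  proof cases
    case 1
    then have "s \<circ> l \<in> gen A" using l gen.gen_step by blast
    then show ?thesis using l by (metis comp_apply)
  next
    case 2
    have "s (l x) = l x" if x: "x \<in> X - left_orbit" for x
    proof -
      have "l x \<in> X" "l x \<notin> left_orbit"
        using x left_permutes[OF l(1)] left_orbit_closed[OF l(1)] by (auto simp: permutes_in_image)
      then have "l x \<notin> Y" using c_in wedge_inter by auto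
      then show ?thesis using wedge_right[OF 2] by (simp add: permutes_not_in)
    qed
    then show ?thesis using l by (metis comp_apply)
  qed
qed

lemma left_moved:
  assumes "s \<in> A" "s c \<noteq> c"
  shows "s c \<in> X \<and> s c \<notin> Y"
proof -
  have "s c \<in> X" using wedge_left[OF assms(1)] c_in(1) by (simp add: permutes_in_image)
  then show ?thesis using assms(2) wedge_inter by blast
qed

lemma right_moved: "t \<in> B \<Longrightarrow> t c \<noteq> c \<Longrightarrow> t c \<in> Y \<and> t c \<notin> X"
  using wedge.left_moved[OF wedge_swap] .

lemma wedge_perm_group: "perm_group (gen (A \<union> B))"
proof
  fix g h assume g: "g \<in> gen (A \<union> B)"
  then show "bij g" "inv' g \<in> gen (A \<union> B)"
    using gen_inverse[OF wedge_invol g] by simp_all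
  assume "h \<in> gen (A \<union> B)"
  then show "g \<circ> h \<in> gen (A \<union> B)" by (rule gen_comp[OF g])
qed (rule gen.gen_id)

text \<open>The commutator of two involutions whose supports meet in a single point is a
  3-cycle.\<close>

lemma wedge_cyc:
  assumes s: "s \<in> A" "s c \<noteq> c" and t: "t \<in> B" "t c \<noteq> c"
  shows "s \<circ> t \<circ> s \<circ> t = cyc c (s c) (t c)" and "distinct [c, s c, t c]"
proof -
  have ss: "s (s x) = x" "t (t x) = x" for x
    using wedge_invol[of s] wedge_invol[of t] s t by (auto simp: fun_eq_iff)
  have sX: "s x \<in> X \<longleftrightarrow> x \<in> X" "x \<notin> X \<Longrightarrow> s x = x" for x
    using wedge_left[OF s(1)] by (auto simp: permutes_in_image permutes_not_in)
  have tY: "t x \<in> Y \<longleftrightarrow> x \<in> Y" "x \<notin> Y \<Longrightarrow> t x = x" for x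
    using wedge_right[OF t(1)] by (auto simp: permutes_in_image permutes_not_in)
  have XY: "x \<in> X \<Longrightarrow> x \<in> Y \<Longrightarrow> x = c" for x using wedge_inter by auto
  have st: "s c \<in> X" "s c \<notin> Y" "t c \<in> Y" "t c \<notin> X"
    using left_moved[OF s] right_moved[OF t] by auto
  then show d: "distinct [c, s c, t c]" using s t by auto
  show "s \<circ> t \<circ> s \<circ> t = cyc c (s c) (t c)"
  proof
    fix x
    consider "x = c" | "x = s c" | "x = t c" | "x \<noteq> c" "x \<noteq> s c" "x \<noteq> t c" by blast
    then show "(s \<circ> t \<circ> s \<circ> t) x = cyc c (s c) (t c) x"
    proof cases
      case 4
      have "s (t (s (t x))) = x"
      proof (cases "x \<in> X")
        case True
        then have "t x = x" using XY 4 tY by metis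
        moreover have "s x \<in> X" "s x \<noteq> c" using True sX 4 ss by metis+
        then have "t (s x) = s x" using XY tY by metis
        ultimately show ?thesis using ss by simp
      next
        case False
        have "t x \<notin> X" using False XY ss tY 4 by metis
        then show ?thesis using ss sX False by metis
      qed
      then show ?thesis using cyc_apply(4)[OF d] 4 by simp
    qed (use cyc_apply[OF d] ss sX tY st in auto)
  qed
qed

text \<open>Conjugates of the 3-cycle link all points of the two orbits of \<open>c\<close>, so the
  group contains every even permutation of their union \<open>?O\<close>. Outside \<open>?O\<close>
  the permutation \<open>p\<close> agrees with \<open>l \<circ> r\<close>; the quotient is even and
  supported on \<open>?O\<close>.\<close>

lemma wedge_member:
  assumes s: "s \<in> A" "s c \<noteq> c" and t: "t \<in> B" "t c \<noteq> c"
    and p: "p permutes X \<union> Y" "evenperm p"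
    and l: "l \<in> gen A" "\<And>x. x \<in> X \<Longrightarrow> x \<notin> left_orbit \<Longrightarrow> p x = l x"
    and r: "r \<in> gen B" "\<And>x. x \<in> Y \<Longrightarrow> x \<notin> right_orbit \<Longrightarrow> p x = r x"
  shows "p \<in> gen (A \<union> B)"
proof -
  interpret W: wedge B A Y X c by (rule wedge_swap)
  interpret G: perm_group "gen (A \<union> B)" by (rule wedge_perm_group)
  let ?O = "left_orbit \<union> right_orbit"
  have A: "g \<in> gen (A \<union> B)" if "g \<in> gen A" for g using gen_mono[of A "A \<union> B"] that by auto
  have B: "g \<in> gen (A \<union> B)" if "g \<in> gen B" for g using gen_mono[of B "A \<union> B"] that by auto
  have d: "distinct [c, s c, t c]" using wedge_cyc(2)[OF s t] .
  have cyc0: "cyc c (s c) (t c) \<in> gen (A \<union> B)"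
    using wedge_cyc(1)[OF s t] s t A B gen_base G.comp_mem by metis
  have dist: "distinct [g c, g (s c), g (t c)]" if "g \<in> gen (A \<union> B)" for g
    using d G.bij_mem[OF that] by (simp add: bij_is_inj inj_eq)
  \<comment> \<open>Elements of \<open>gen A\<close> fix \<open>t c\<close>, which lies outside
    \<open>X\<close>. Conjugating the basic 3-cycle by them therefore links every point of the left
    orbit to the same point \<open>t c\<close>; on the other side \<open>s c\<close> has this
    role.\<close>
  have link_t: "G.linked (g c) (t c)" if "g \<in> gen A" for g
  proof -
    have "g (t c) = t c"
      using left_permutes[OF that] right_moved[OF t] by (simp add: permutes_not_in)
    then have "cyc (g c) (g (s c)) (t c) \<in> gen (A \<union> B)" "distinct [g c, g (s c), t c]"
      using G.cyc_conj[OF A[OF that] cyc0] dist[OF A[OF that]] by auto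
    then have "cyc (t c) (g c) (g (s c)) \<in> gen (A \<union> B)" "distinct [t c, g c, g (s c)]"
      using cyc_rotate[of "t c" "g c" "g (s c)"] by auto
    then show ?thesis using G.linked_sym unfolding G.linked_def by blast
  qed
  have link_s: "G.linked (g c) (s c)" if "g \<in> gen B" for g
  proof -
    have "g (s c) = s c"
      using right_permutes[OF that] left_moved[OF s] by (simp add: permutes_not_in)
    then show ?thesis
      using G.cyc_conj[OF B[OF that] cyc0] dist[OF B[OF that]] unfolding G.linked_def by metis
  qed
  have link_c: "G.linked x c" if "x \<in> ?O" for x
  proof -
    have ct: "G.linked (t c) c" and cs: "G.linked (s c) c"
      using G.linked_sym[OF link_t[OF gen.gen_id]] G.linked_sym[OF link_s[OF gen.gen_id]] by auto
    from that consider g where "g \<in> gen A" "x = g c" | g where "g \<in> gen B" "x = g c" by blast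
    then show ?thesis
      by cases (use G.linked_trans[OF link_t ct] G.linked_trans[OF link_s cs] in simp_all)
  qed
  have cycles: "cyc x y z \<in> gen (A \<union> B)" if d: "distinct [x, y, z]" and "{x, y, z} \<subseteq> ?O" for x y z
  proof -
    have "x \<in> ?O" "y \<in> ?O" "z \<in> ?O" using that(2) by simp_all
    then have x: "G.linked x c" and y: "G.linked c y" and z: "G.linked c z"
      using link_c[of x] G.linked_sym[OF link_c[of y]] G.linked_sym[OF link_c[of z]] by simp_all
    show ?thesis
      by (rule G.cyc_mem_of_linked[OF G.linked_trans[OF x y] G.linked_trans[OF x z] d])
  qed
  have "finite ?O"
    by (rule finite_UnI[OF finite_subset[OF left_orbit_subset wedge_finite(1)]
          finite_subset[OF W.left_orbit_subset wedge_finite(2)]])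
  have lr: "l \<circ> r \<in> gen (A \<union> B)" by (rule G.comp_mem[OF A[OF l(1)] B[OF r(1)]])
  define h where "h = inv' (l \<circ> r) \<circ> p"
  have ph: "p = (l \<circ> r) \<circ> h" unfolding h_def using G.bij_mem[OF lr] by (simp only: bij_cancel)
  have bij_h: "bij h"
    unfolding h_def by (rule bij_comp[OF permutes_bij[OF p(1)] G.bij_mem[OF G.inv_mem[OF lr]]])
  have "h x = x" if x: "x \<notin> ?O" for x
  proof -
    have "p x = l (r x)"
    proof (cases "x \<in> X")
      case True
      then have "x \<notin> Y" using x wedge_inter c_in by auto
      then show ?thesis using True x l right_permutes[OF r(1)] by (simp add: permutes_not_in)
    next
      case nX: False
      show ?thesis
      proof (cases "x \<in> Y")
        case True
        then have "r x \<in> Y" "r x \<notin> right_orbit"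
          using right_permutes[OF r(1)] W.left_orbit_closed[OF r(1)] x by (auto simp: permutes_in_image)
        then have "r x \<notin> X" using W.c_in wedge_inter by auto
        then show ?thesis
          using True x r(2) left_permutes[OF l(1)] by (simp add: permutes_not_in)
      next
        case False
        then show ?thesis
          using nX p(1) left_permutes[OF l(1)] right_permutes[OF r(1)] by (simp add: permutes_not_in)
      qed
    qed
    then show ?thesis
      unfolding h_def using G.bij_mem[OF lr] by (simp add: inv_f_eq bij_is_inj)
  qed
  then have ph_O: "h permutes ?O" by (intro bij_imp_permutes_ext bij_h)
  have pl: "permutation l" "permutation r" and "evenperm l" "evenperm r"
    using left_permutation[OF l(1)] W.left_permutation[OF r(1)] left_even[OF l(1)] W.left_even[OF r(1)]
    by simp_all
  then have plr: "permutation (l \<circ> r)" "evenperm (l \<circ> r)"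
    by (simp_all only: evenperm_comp[OF pl] permutation_compose)
  have pp: "permutation p"
    using p(1) wedge_finite permutes_imp_permutation by blast
  have "evenperm h"
    unfolding h_def evenperm_comp[OF permutation_inverse[OF plr(1)] pp] evenperm_inv[OF plr(1)]
    using plr p by simp
  then have "h \<in> gen (A \<union> B)"
    by (intro G.even_mem_of_cycles[OF \<open>finite ?O\<close> ph_O] cycles)
  then show ?thesis unfolding ph by (rule G.comp_mem[OF lr])
qed

end

section \<open>Doubling a half system\<close>

text \<open>Fixing the only shared point makes the supports disjoint.\<close>

lemma wedge_permutes_commute:
  assumes "p permutes X" "q permutes Y" "X \<inter> Y = {c}" "p c = c"
  shows "p \<circ> q = q \<circ> p"
proof
  fix x
  have p: "p y \<in> X \<longleftrightarrow> y \<in> X" "y \<notin> X \<Longrightarrow> p y = y" for y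
    using assms(1) by (auto simp: permutes_in_image permutes_not_in)
  have q: "q y \<in> Y \<longleftrightarrow> y \<in> Y" "y \<notin> Y \<Longrightarrow> q y = y" for y
    using assms(2) by (auto simp: permutes_in_image permutes_not_in)
  have Y: "p y = y" if "y \<in> Y" for y using that assms(3,4) p(2)[of y] by (metis IntI singletonD)
  show "(p \<circ> q) x = (q \<circ> p) x"
  proof (cases "x \<in> Y")
    case True
    then show ?thesis using Y q by simp
  next
    case False
    have "p x \<notin> Y"
    proof
      assume "p x \<in> Y"
      then have "p (p x) = p x" by (rule Y)
      then show False using \<open>p x \<in> Y\<close> False permutes_inj[OF assms(1)] by (simp add: inj_eq)
    qed
    then show ?thesis using False q by simp
  qed
qed

text \<open>The assumption \<open>detached\<close> is what the intersection condition of the doubled system requires of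
  the intervals that end in the middle.\<close>

locale half_system = interval_intersection \<rho> m
  for \<rho> :: "nat \<Rightarrow> 'a \<Rightarrow> 'a" and m :: nat +
  fixes X :: "'a set" and c :: 'a
  assumes finite_X: "finite X"
    and two_le: "2 \<le> m"
    and permutes_X: "i < m \<Longrightarrow> \<rho> i permutes X"
    and even_\<rho>: "i < m \<Longrightarrow> evenperm (\<rho> i)"
    and nontrivial_\<rho>: "i < m \<Longrightarrow> \<rho> i \<noteq> id"
    and fixes_c: "Suc i < m \<Longrightarrow> \<rho> i c = c"
    and moves_c: "\<rho> (m - 1) c \<noteq> c"
    and transitive: "X \<subseteq> (\<lambda>g. g c) ` span {..<m}"
    and detached: "Suc i < m \<Longrightarrow> g \<in> span {i..<m} \<Longrightarrow>
      (\<And>x. x \<notin> (\<lambda>h. h c) ` span {Suc i..<m} \<Longrightarrow> g x = x) \<Longrightarrow> g \<in> span {Suc i..<m}"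

locale doubled_system = half_system +
  fixes \<delta> :: "'a \<Rightarrow> 'a"
  assumes \<delta>_invol: "\<delta> \<circ> \<delta> = id"
    and permutation_\<delta>: "permutation \<delta>"
    and \<delta>_c: "\<delta> c = c"
    and X_\<delta>: "X \<inter> \<delta> ` X = {c}"
begin

text \<open>Conjugation by \<open>\<delta>\<close> in reversed order makes the sequence a palindrome
  up to \<open>\<delta>\<close>. The value \<open>id\<close> from \<open>2 * m\<close> on makes the
  axioms of \<open>commuting_involutions\<close> hold for all indices.\<close>

definition \<tau> :: "nat \<Rightarrow> 'a \<Rightarrow> 'a"
  where "\<tau> i = (if i < m then \<rho> i else if i < 2 * m then \<delta> \<circ> \<rho> (2 * m - 1 - i) \<circ> \<delta> else id)"

lemma \<delta>_\<delta> [simp]: "\<delta> (\<delta> x) = x"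
  using \<delta>_invol by (simp add: fun_eq_iff)

lemma \<tau>_dual: "i < 2 * m \<Longrightarrow> \<tau> (2 * m - 1 - i) = \<delta> \<circ> \<tau> i \<circ> \<delta>"
  by (auto simp: \<tau>_def fun_eq_iff)

lemma \<tau>_left: "i < m \<Longrightarrow> \<tau> i permutes X"
  by (simp add: \<tau>_def permutes_X)

lemma \<tau>_right:
  assumes "m \<le> i" "i < 2 * m" shows "\<tau> i permutes \<delta> ` X"
proof (rule bij_imp_permutes_ext)
  let ?j = "2 * m - 1 - i"
  have p: "\<rho> ?j permutes X" using permutes_X[of ?j] assms by simp
  have "bij \<delta>" using \<delta>_invol by (rule o_bij) (rule \<delta>_invol)
  then show "bij (\<tau> i)" using assms permutes_bij[OF p] by (simp add: \<tau>_def bij_comp)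
  fix x assume "x \<notin> \<delta> ` X"
  then have "\<delta> x \<notin> X" by (metis \<delta>_\<delta> imageI)
  then show "\<tau> i x = x" using assms permutes_not_in[OF p] by (simp add: \<tau>_def)
qed

lemma \<tau>_invol: "\<tau> i \<circ> \<tau> i = id"
proof -
  have "\<delta> \<circ> \<rho> j \<circ> \<delta> \<circ> (\<delta> \<circ> \<rho> j \<circ> \<delta>) = id" for j
    using invol[of j] by (auto simp: fun_eq_iff)
  then show ?thesis using invol by (simp add: \<tau>_def)
qed

lemma \<tau>_even: "evenperm (\<tau> i)"
proof (cases "i < m \<or> 2 * m \<le> i")
  case True
  then show ?thesis using even_\<rho> by (auto simp: \<tau>_def)
next
  case False
  let ?j = "2 * m - 1 - i"
  have j: "?j < m" using False by auto
  have p: "permutation (\<rho> ?j)"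
    using permutes_X[OF j] finite_X permutes_imp_permutation by blast
  have "evenperm (\<delta> \<circ> \<rho> ?j \<circ> \<delta>)"
    unfolding evenperm_comp[OF permutation_compose[OF permutation_\<delta> p] permutation_\<delta>]
      evenperm_comp[OF permutation_\<delta> p] using even_\<rho>[OF j] by simp
  then show ?thesis using False by (simp add: \<tau>_def)
qed

lemma \<tau>_nontrivial: "i < 2 * m \<Longrightarrow> \<tau> i \<noteq> id"
proof
  assume i: "i < 2 * m" "\<tau> i = id"
  show False
  proof (cases "i < m")
    case True
    then show ?thesis using i nontrivial_\<rho> by (simp add: \<tau>_def)
  next
    case False
    let ?j = "2 * m - 1 - i"
    have j: "?j < m" "\<delta> \<circ> \<rho> ?j \<circ> \<delta> = id" using False i by (auto simp: \<tau>_def)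
    have "\<rho> ?j = \<delta> \<circ> (\<delta> \<circ> \<rho> ?j \<circ> \<delta>) \<circ> \<delta>" by (simp add: fun_eq_iff)
    also have "\<dots> = id" unfolding j(2) using \<delta>_invol by simp
    finally show ?thesis using nontrivial_\<rho>[OF j(1)] by simp
  qed
qed

lemma \<tau>_comm:
  assumes "i + 2 \<le> j" shows "\<tau> i \<circ> \<tau> j = \<tau> j \<circ> \<tau> i"
proof -
  consider "j < m" | "2 * m \<le> j" | "m \<le> i" "j < 2 * m" | "i < m" "m \<le> j" "j < 2 * m"
    using assms by linarith
  then show ?thesis
  proof cases
    case 1
    then show ?thesis using comm[OF assms] assms by (simp add: \<tau>_def)
  next
    case 2
    then show ?thesis by (simp add: \<tau>_def)
  next
    case 3
    then have "\<rho> (2 * m - 1 - j) \<circ> \<rho> (2 * m - 1 - i) = \<rho> (2 * m - 1 - i) \<circ> \<rho> (2 * m - 1 - j)"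
      by (intro comm) (use assms in auto)
    then show ?thesis using 3 assms by (auto simp: \<tau>_def fun_eq_iff)
  next
    case 4
    \<comment> \<open>Since \<open>i + 2 \<le> j\<close>, the indices are not both innermost, so one
      of the two permutations fixes \<open>c\<close> and the supports are disjoint.\<close>
    note p = \<tau>_left[OF 4(1)] and q = \<tau>_right[OF 4(2,3)]
    show ?thesis
    proof (cases "Suc i < m")
      case True
      then show ?thesis
        using wedge_permutes_commute[OF p q X_\<delta>] fixes_c[of i] by (simp add: \<tau>_def)
    next
      case False
      then have "\<tau> j c = c"
        using fixes_c[of "2 * m - 1 - j"] 4 assms \<delta>_c by (auto simp: \<tau>_def)
      then show ?thesis
        using wedge_permutes_commute[OF q p] X_\<delta> by (metis Int_commute)
    qed
  qed
qed

sublocale T: commuting_involutions \<tau>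
  by unfold_locales (auto intro: \<tau>_invol \<tau>_comm)

lemma T_span_left: "I \<subseteq> {..<m} \<Longrightarrow> T.span I = span I"
  by (rule arg_cong[of _ _ gen], rule image_cong) (auto simp: \<tau>_def)

lemma T_span_left_interval: "j \<le> m \<Longrightarrow> T.span {i..<j} = span {i..<j}"
  by (rule T_span_left) auto

lemma T_span_dual:
  assumes "I \<subseteq> {..<2 * m}" "g \<in> T.span I"
  shows "\<delta> \<circ> g \<circ> \<delta> \<in> T.span ((\<lambda>i. 2 * m - 1 - i) ` I)"
proof -
  have "(\<lambda>s. \<delta> \<circ> s \<circ> \<delta>) ` \<tau> ` I = \<tau> ` (\<lambda>i. 2 * m - 1 - i) ` I"
    using assms(1) \<tau>_dual by (force simp: image_image)
  then show ?thesis using gen_image_conj[OF \<delta>_invol assms(2)] by simp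
qed

lemma T_span_dual_interval:
  assumes "g \<in> T.span {i..<j}" "j \<le> 2 * m"
  shows "\<delta> \<circ> g \<circ> \<delta> \<in> T.span {2 * m - j..<2 * m - i}"
proof (rule T.span_monoD[OF T_span_dual])
  show "(\<lambda>i. 2 * m - 1 - i) ` {i..<j} \<subseteq> {2 * m - j..<2 * m - i}"
    using assms(2) by auto
qed (use assms in auto)

lemma wedge_\<tau>: "I \<subseteq> {..<m} \<Longrightarrow> J \<subseteq> {m..<2 * m} \<Longrightarrow> wedge (\<tau> ` I) (\<tau> ` J) X (\<delta> ` X) c"
  using finite_X X_\<delta>
  by unfold_locales (auto simp: \<tau>_invol \<tau>_even intro!: \<tau>_left \<tau>_right)

lemma T_span_split:
  assumes "i \<le> m" "m \<le> j"
  shows "T.span {i..<j} = gen (\<tau> ` {i..<m} \<union> \<tau> ` {m..<j})"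
proof -
  have "{i..<j} = {i..<m} \<union> {m..<j}" using assms by auto
  then show ?thesis by (simp add: image_Un)
qed

lemma T_span_permutes:
  assumes "I \<subseteq> {..<2 * m}" "g \<in> T.span I"
  shows "g permutes (X \<union> \<delta> ` X)"
  using assms(2)
proof induction
  case (gen_step s g)
  then obtain i where i: "i \<in> I" "s = \<tau> i" by blast
  have "s permutes (X \<union> \<delta> ` X)"
  proof (cases "i < m")
    case True
    then show ?thesis unfolding i(2) by (intro permutes_subset[OF \<tau>_left]) auto
  next
    case False
    then show ?thesis
      unfolding i(2) using i(1) assms(1) by (intro permutes_subset[OF \<tau>_right]) auto
  qed
  then show ?case using gen_step permutes_compose by blast
qed (rule permutes_id)

lemma T_span_even:
  assumes "I \<subseteq> {..<2 * m}" "g \<in> T.span I"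
  shows "evenperm g"
  using assms(2)
proof induction
  case (gen_step s g)
  then obtain i where i: "i \<in> I" "s = \<tau> i" by blast
  have fin: "finite (X \<union> \<delta> ` X)" using finite_X by simp
  note perm = permutes_imp_permutation[OF fin T_span_permutes[OF assms(1)]]
  have "permutation s" "permutation g"
    by (rule perm[OF gen_base[OF gen_step(1)]], rule perm[OF gen_step(2)])
  then show ?case unfolding i(2) using evenperm_comp \<tau>_even gen_step(3) by metis
qed simp

section \<open>Shifted intervals in the doubled system\<close>

lemma \<tau>_m: "\<tau> m c \<noteq> c"
proof
  assume "\<tau> m c = c"
  then have "\<delta> (\<rho> (m - 1) c) = c" using two_le \<delta>_c by (simp add: \<tau>_def)
  then have "\<rho> (m - 1) c = c" using \<delta>_c by (metis \<delta>_\<delta>)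
  then show False using moves_c by simp
qed

lemma \<tau>_m1: "\<tau> (m - 1) c \<noteq> c"
  using two_le moves_c by (simp add: \<tau>_def)

text \<open>Each membership controls one side: the second allows only left generators from
  \<open>Suc i\<close> on, the first only right generators below \<open>j\<close>. So
  \<open>wedge_agree\<close> supplies exactly the factors \<open>l\<close> and \<open>r\<close> that
  \<open>wedge_member\<close> asks for, and the common interval still contains the two middle
  generators.\<close>

lemma step_crossing:
  assumes i: "Suc i < m" and j: "m < j" "j < 2 * m"
    and g: "g \<in> T.span {i..<j}" "g \<in> T.span {Suc i..<Suc j}"
  shows "g \<in> T.span {Suc i..<j}"
proof -
  let ?A = "\<tau> ` {Suc i..<m}" and ?B = "\<tau> ` {m..<j}"
  interpret W1: wedge ?A "\<tau> ` {m..<Suc j}" X "\<delta> ` X" c by (rule wedge_\<tau>) (use j in auto)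
  interpret W2: wedge ?B "\<tau> ` {i..<m}" "\<delta> ` X" X c
    by (rule wedge.wedge_swap[OF wedge_\<tau>]) (use j in auto)
  interpret W: wedge ?A ?B X "\<delta> ` X" c by (rule wedge_\<tau>) (use j in auto)
  have g1: "g \<in> gen (?A \<union> \<tau> ` {m..<Suc j})" and g2: "g \<in> gen (?B \<union> \<tau> ` {i..<m})"
    using g i j T_span_split[of "Suc i" "Suc j"] T_span_split[of i j] by (auto simp: Un_commute)
  obtain l where l: "l \<in> gen ?A" "\<forall>x \<in> X - W.left_orbit. g x = l x"
    using W1.wedge_agree[OF g1] by (elim bexE)
  obtain r where r: "r \<in> gen ?B" "\<forall>x \<in> \<delta> ` X - W.right_orbit. g x = r x"
    using W2.wedge_agree[OF g2] by (elim bexE)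
  have "{i..<j} \<subseteq> {..<2 * m}" using j by auto
  then have p: "g permutes X \<union> \<delta> ` X" "evenperm g"
    using T_span_permutes[OF _ g(1)] T_span_even[OF _ g(1)] by blast+
  have s: "\<tau> (m - 1) \<in> ?A" and t: "\<tau> m \<in> ?B" using i j by auto
  have "g \<in> gen (?A \<union> ?B)"
    by (rule W.wedge_member[OF s \<tau>_m1 t \<tau>_m p l(1) _ r(1)])
      (rule l(2)[rule_format, OF DiffI] r(2)[rule_format, OF DiffI]; assumption)+
  then show ?thesis using T_span_split[of "Suc i" j] i j by simp
qed

text \<open>The common interval has no right generator and hence no 3-cycle. After division by
  \<open>l\<close> the quotient stays in the left span from \<open>i\<close> and fixes everything
  off the orbit of \<open>c\<close> under the shorter interval, which is the situation of
  \<open>detached\<close>.\<close>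

lemma step_border:
  assumes i: "Suc i < m" and g: "g \<in> T.span {i..<m}" "g \<in> T.span {Suc i..<Suc m}"
  shows "g \<in> T.span {Suc i..<m}"
proof -
  let ?A = "\<tau> ` {Suc i..<m}" and ?B = "\<tau> ` {m..<Suc m}"
  interpret W: wedge ?A ?B X "\<delta> ` X" c by (rule wedge_\<tau>) (use i in auto)
  interpret V: wedge "\<tau> ` {i..<m}" ?B X "\<delta> ` X" c by (rule wedge_\<tau>) (use i in auto)
  have A: "gen ?A = span {Suc i..<m}" by (rule T_span_left) auto
  have "g \<in> gen (?A \<union> ?B)" using g i T_span_split[of "Suc i" "Suc m"] by auto
  from W.wedge_agree[OF this] obtain l
    where l: "l \<in> gen ?A" "\<forall>x \<in> X - W.left_orbit. g x = l x"
    by (elim bexE)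
  have bl: "bij l" "inv' l \<in> gen ?A" using T.span_bij T.span_inv l(1) by auto
  define h where "h = inv' l \<circ> g"
  have gh: "g = l \<circ> h" unfolding h_def using bl by (simp add: bij_cancel)
  have "inv' l \<in> T.span {i..<m}" by (rule T.span_monoD[OF bl(2)]) auto
  then have "h \<in> T.span {i..<m}" unfolding h_def using g(1) by (rule gen_comp)
  then have "h \<in> span {i..<m}" using T_span_left_interval[of m i] by simp
  moreover have "h x = x" if "x \<notin> W.left_orbit" for x
  proof -
    have "g x = l x"
    proof (cases "x \<in> X")
      case False
      then show ?thesis
        using V.left_permutes[OF g(1)] W.left_permutes[OF l(1)] by (simp add: permutes_not_in)
    qed (use that l in auto)
    then show ?thesis unfolding h_def using bl(1) by (simp add: bij_is_inj)
  qed
  ultimately have "h \<in> span {Suc i..<m}"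
    using detached[OF i] unfolding A by blast
  then show ?thesis unfolding gh using l(1) unfolding A by (intro gen_comp) auto
qed

lemma step_lower:
  assumes ij: "i < j" "i + j < 2 * m"
    and g: "g \<in> T.span {i..<j}" "g \<in> T.span {Suc i..<Suc j}"
  shows "g \<in> T.span {Suc i..<j}"
proof -
  consider "j < m" | "j = m" "Suc i < m" | "j = m" "Suc i = m" | "m < j" "Suc i < m"
    using ij by linarith
  then show ?thesis
  proof cases
    case 1
    then show ?thesis
      using interval_step[OF ij(1)] g by (auto simp: T_span_left_interval)
  next
    case 2
    then show ?thesis using step_border g by simp
  next
    case 3
    \<comment> \<open>The two spans are generated by the two middle involutions alone. Their domains
      share only \<open>c\<close>, so a common element moves at most one point and is the
      identity.\<close>
    interpret V: wedge "\<tau> ` {i..<m}" "\<tau> ` {m..<Suc m}" X "\<delta> ` X" c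
      by (rule wedge_\<tau>) (use two_le in auto)
    have g1: "g \<in> gen (\<tau> ` {i..<m})" and g2: "g \<in> gen (\<tau> ` {m..<Suc m})"
      using g 3 by simp_all
    have "g x = x" if "x \<noteq> c" for x
    proof -
      have "x \<notin> X \<or> x \<notin> \<delta> ` X" using that X_\<delta> by blast
      then show ?thesis
        using permutes_not_in[OF V.left_permutes[OF g1]] permutes_not_in[OF V.right_permutes[OF g2]]
        by blast
    qed
    then have "g permutes {c}"
      by (intro bij_imp_permutes_ext T.span_bij[OF g(1)]) simp
    then show ?thesis using 3 by simp
  next
    case 4
    then show ?thesis using step_crossing g ij by simp
  qed
qed

sublocale T: interval_intersection \<tau> "2 * m"
proof
  fix i j :: nat assume ij: "i < j" "j < 2 * m"
  show "T.span {i..<j} \<inter> T.span {Suc i..<Suc j} \<subseteq> T.span {Suc i..<j}"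
  proof
    fix g assume "g \<in> T.span {i..<j} \<inter> T.span {Suc i..<Suc j}"
    then have g: "g \<in> T.span {i..<j}" "g \<in> T.span {Suc i..<Suc j}" by auto
    show "g \<in> T.span {Suc i..<j}"
    proof (cases "i + j < 2 * m")
      case True
      then show ?thesis using step_lower ij g by blast
    next
      case False
      \<comment> \<open>Conjugation by \<open>\<delta>\<close> exchanges the two intervals and turns
        the index sum \<open>i + j\<close> into \<open>4 * m - 2 - (i + j)\<close>, which is below
        \<open>2 * m\<close>.\<close>
      let ?i = "2 * m - Suc j" and ?j = "2 * m - Suc i"
      have eq: "2 * m - j = Suc ?i" "2 * m - i = Suc ?j" using ij by auto
      have "\<delta> \<circ> g \<circ> \<delta> \<in> T.span {Suc ?i..<?j}"
        using step_lower[of ?i ?j "\<delta> \<circ> g \<circ> \<delta>"] T_span_dual_interval[OF g(1)]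
          T_span_dual_interval[OF g(2)] ij False unfolding eq by simp
      from T_span_dual_interval[OF this]
      have "\<delta> \<circ> (\<delta> \<circ> g \<circ> \<delta>) \<circ> \<delta> \<in> T.span {Suc i..<j}"
        using ij by (simp add: Suc_diff_Suc)
      moreover have "\<delta> \<circ> (\<delta> \<circ> g \<circ> \<delta>) \<circ> \<delta> = g" by (simp add: fun_eq_iff)
      ultimately show ?thesis by simp
    qed
  qed
qed

text \<open>The orbits of \<open>c\<close> fill both halves, so the agreement conditions of
  \<open>wedge_member\<close> are vacuous and the identity serves for \<open>l\<close> and
  \<open>r\<close>.\<close>

theorem T_span_all: "T.span {..<2 * m} = {p. p permutes (X \<union> \<delta> ` X) \<and> evenperm p}"
proof
  show "T.span {..<2 * m} \<subseteq> {p. p permutes (X \<union> \<delta> ` X) \<and> evenperm p}"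
    using T_span_permutes T_span_even by blast
  let ?A = "\<tau> ` {0..<m}" and ?B = "\<tau> ` {m..<2 * m}"
  interpret W: wedge ?A ?B X "\<delta> ` X" c by (rule wedge_\<tau>) auto
  have A: "X \<subseteq> W.left_orbit"
    using transitive T_span_left[of "{0..<m}"] by (simp add: atLeast0LessThan)
  have B: "\<delta> ` X \<subseteq> W.right_orbit"
  proof
    fix y assume "y \<in> \<delta> ` X"
    then obtain g where g: "g \<in> gen ?A" "y = \<delta> (g c)" using A by blast
    then have "\<delta> \<circ> g \<circ> \<delta> \<in> T.span {m..<2 * m}"
      using T_span_dual_interval[of g 0 m] by simp
    moreover have "y = (\<delta> \<circ> g \<circ> \<delta>) c" using g \<delta>_c by simp
    ultimately show "y \<in> W.right_orbit" by blast
  qed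
  show "{p. p permutes (X \<union> \<delta> ` X) \<and> evenperm p} \<subseteq> T.span {..<2 * m}"
  proof
    fix p assume "p \<in> {p. p permutes (X \<union> \<delta> ` X) \<and> evenperm p}"
    then have p: "p permutes X \<union> \<delta> ` X" "evenperm p" by auto
    have s: "\<tau> (m - 1) \<in> ?A" and t: "\<tau> m \<in> ?B" using two_le by auto
    have "p \<in> gen (?A \<union> ?B)"
      by (rule W.wedge_member[OF s \<tau>_m1 t \<tau>_m p gen_id _ gen_id]) (use A B in blast)+
    then show "p \<in> T.span {..<2 * m}"
      using T_span_split[of 0 "2 * m"] by (simp add: atLeast0LessThan)
  qed
qed

end

section \<open>Permutations of two rows of points\<close>

text \<open>Column \<open>x\<close> consists of \<open>pt x False = 2x+1\<close> and \<open>pt x True = 2x+2\<close>; the middle point is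
  \<open>pt m True\<close>.  The permutation \<open>W \<sigma> f\<close> moves column \<open>x\<close> to column \<open>\<sigma> x\<close> and swaps the rows iff
  \<open>f x\<close> holds.\<close>

definition pt :: "nat \<Rightarrow> bool \<Rightarrow> nat"
  where "pt x b = 2 * x + of_bool b + 1"

definition W :: "(nat \<Rightarrow> nat) \<Rightarrow> (nat \<Rightarrow> bool) \<Rightarrow> nat \<Rightarrow> nat"
  where "W \<sigma> f y =
    (if y = 0 then 0 else pt (\<sigma> ((y - 1) div 2)) (odd (y - 1) \<noteq> f ((y - 1) div 2)))"

lemma pt_eq_iff [simp]: "pt x b = pt y d \<longleftrightarrow> x = y \<and> b = d"
  unfolding pt_def by (cases b; cases d; simp; presburger)

lemma pt_neq_0 [simp]: "pt x b \<noteq> 0"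
  by (simp add: pt_def)

lemma pt_cases:
  obtains "y = 0" | x b where "y = pt x b"
proof (cases y)
  case (Suc z)
  then have "y = pt (z div 2) (odd z)"
    by (simp add: pt_def of_bool_odd_eq_mod_2)
  then show ?thesis using that by blast
qed (use that in blast)

lemma pt_mem_iff: "pt x b \<in> {1..2 * m + 2} \<longleftrightarrow> x \<le> m"
  by (cases b) (auto simp: pt_def)

lemma W_0 [simp]: "W \<sigma> f 0 = 0"
  by (simp add: W_def)

lemma W_pt [simp]: "W \<sigma> f (pt x b) = pt (\<sigma> x) (b \<noteq> f x)"
  by (cases b) (simp_all add: W_def pt_def)

lemma pt_ext:
  assumes "g 0 = h 0" "\<And>x b. g (pt x b) = h (pt x b)"
  shows "g = h"
proof
  fix y show "g y = h y" by (cases y rule: pt_cases) (use assms in auto)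
qed

lemma W_comp: "W \<sigma> f \<circ> W \<tau> g = W (\<sigma> \<circ> \<tau>) (\<lambda>x. g x \<noteq> f (\<tau> x))"
  by (rule pt_ext) auto

lemma W_id: "W id (\<lambda>_. False) = id"
  by (rule pt_ext) auto

lemma W_eq_iff: "W \<sigma> f = W \<tau> g \<longleftrightarrow> \<sigma> = \<tau> \<and> f = g"
proof
  assume eq: "W \<sigma> f = W \<tau> g"
  have "\<sigma> x = \<tau> x \<and> f x = g x" for x
    using fun_cong[OF eq, of "pt x False"] by simp
  then show "\<sigma> = \<tau> \<and> f = g" by (intro conjI ext) simp_all
qed simp

lemma W_eqI: "(\<And>x. \<sigma> x = \<tau> x) \<Longrightarrow> (\<And>x. f x = g x) \<Longrightarrow> W \<sigma> f = W \<tau> g"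
  unfolding W_eq_iff by blast

lemma W_eq_id_iff: "W \<sigma> f = id \<longleftrightarrow> \<sigma> = id \<and> f = (\<lambda>_. False)"
  using W_eq_iff[of \<sigma> f id "\<lambda>_. False"] by (simp add: W_id)

lemma W_permutes:
  assumes "bij (W \<sigma> f)" "\<And>x. m < x \<Longrightarrow> \<sigma> x = x \<and> \<not> f x"
  shows "W \<sigma> f permutes {1..2 * m + 2}"
proof (rule bij_imp_permutes_ext[OF assms(1)])
  fix y assume y: "y \<notin> {1..2 * m + 2}"
  show "W \<sigma> f y = y"
  proof (cases y rule: pt_cases)
    case (2 x b)
    then have "m < x" using y pt_mem_iff[of x b m] by (metis not_le)
    then show ?thesis using assms(2) 2 by auto
  qed simp
qed

lemma even_W_transpose: "evenperm (W (transpose i j) (\<lambda>_. False))"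
proof -
  have "W (transpose i j) (\<lambda>_. False) =
      transpose (pt i False) (pt j False) \<circ> transpose (pt i True) (pt j True)"
    by (rule pt_ext) (auto simp: transpose_def)
  then show ?thesis
    by (simp only: evenperm_comp[OF permutation_swap_id permutation_swap_id]) (simp add: evenperm_swap)
qed

lemma even_W_flip_pair:
  assumes "i \<noteq> j"
  shows "evenperm (W id (\<lambda>x. x = i \<or> x = j))"
proof -
  have "W id (\<lambda>x. x = i \<or> x = j) =
      transpose (pt i False) (pt i True) \<circ> transpose (pt j False) (pt j True)"
    using assms by (intro pt_ext) (auto simp: transpose_def)
  then show ?thesis
    by (simp only: evenperm_comp[OF permutation_swap_id permutation_swap_id]) (simp add: evenperm_swap)
qed

lemma permutation_W:
  assumes "bij (W \<sigma> f)" "\<And>x. m < x \<Longrightarrow> \<sigma> x = x \<and> \<not> f x"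
  shows "permutation (W \<sigma> f)"
  using W_permutes[OF assms] permutes_imp_permutation by blast

lemma bij_W_involution:
  assumes "\<sigma> \<circ> \<sigma> = id" "\<And>x. f (\<sigma> x) = f x"
  shows "bij (W \<sigma> f)"
proof -
  have "W \<sigma> f \<circ> W \<sigma> f = id"
    using assms by (simp add: W_comp W_eq_id_iff)
  then show ?thesis by (metis o_bij)
qed

lemma even_W_flip_below: "even k \<Longrightarrow> evenperm (W id (\<lambda>x. x < k))"
proof (induction k rule: nat_less_induct)
  case (1 k)
  show ?case
  proof (cases k)
    case 0
    then have "(\<lambda>x. x < k) = (\<lambda>_. False)" by simp
    then show ?thesis using W_id evenperm_id by metis
  next
    case (Suc k')
    then obtain l where k: "k = Suc (Suc l)" using 1(2) by (cases k') auto
    have eq: "W id (\<lambda>x. x < k) = W id (\<lambda>x. x < l) \<circ> W id (\<lambda>x. x = l \<or> x = Suc l)"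
      unfolding k W_comp W_eq_iff by (auto simp: fun_eq_iff)
    have p: "permutation (W id (\<lambda>x. x < l))" "permutation (W id (\<lambda>x. x = l \<or> x = Suc l))"
      by (rule permutation_W[of _ _ "Suc l"], rule bij_W_involution; simp)+
    show ?thesis
      unfolding eq evenperm_comp[OF p] using 1(1)[rule_format, of l] 1(2) k even_W_flip_pair[of l "Suc l"]
      by (metis even_Suc lessI less_SucI n_not_Suc_n)
  qed
qed

lemma W_gen_form:
  assumes "g \<in> gen ((\<lambda>i. W (s i) (u i)) ` I)" "Q id (\<lambda>_. False)"
    and "\<And>i \<sigma> f. i \<in> I \<Longrightarrow> Q \<sigma> f \<Longrightarrow> Q (s i \<circ> \<sigma>) (\<lambda>x. f x \<noteq> u i (\<sigma> x))"
  shows "\<exists>\<sigma> f. g = W \<sigma> f \<and> Q \<sigma> f"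
  using assms(1)
proof induction
  case gen_id
  show ?case using assms(2) W_id by metis
next
  case (gen_step t g)
  then obtain i \<sigma> f where "i \<in> I" "t = W (s i) (u i)" "g = W \<sigma> f" "Q \<sigma> f" by blast
  then show ?case using assms(3) W_comp by metis
qed

text \<open>The induction principle behind the invariants of spans: \<open>Q\<close> is a property
  of the pair of column permutation and flips, a pair that is determined by the permutation.\<close>

lemma W_gen_inv:
  assumes "W \<sigma> f \<in> gen ((\<lambda>i. W (s i) (u i)) ` I)" "Q id (\<lambda>_. False)"
    and "\<And>i \<sigma> f. i \<in> I \<Longrightarrow> Q \<sigma> f \<Longrightarrow> Q (s i \<circ> \<sigma>) (\<lambda>x. f x \<noteq> u i (\<sigma> x))"
  shows "Q \<sigma> f"
  using W_gen_form[of _ s u I Q, OF assms] by (auto simp: W_eq_iff)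

text \<open>Sorting: the image of the last point is raised one step at a time until that point is
  fixed, and the rest is a permutation of a shorter interval.\<close>

lemma adjacent_transpositions_generate:
  "\<sigma> permutes {a..b} \<Longrightarrow> \<sigma> \<in> gen ((\<lambda>i. transpose i (Suc i)) ` {a..<b})"
proof (induction b arbitrary: \<sigma>)
  case 0
  have "{a..0} = {} \<or> {a..0} = {0}" by auto
  then have "\<sigma> = id" using 0 permutes_empty permutes_sing by metis
  then show ?case using gen_id by metis
next
  case (Suc b)
  show ?case
    using Suc.prems
  proof (induction "Suc b - \<sigma> (Suc b)" arbitrary: \<sigma>)
    case 0
    have le: "\<sigma> (Suc b) \<le> Suc b"
      using 0(2) by (metis atLeastAtMost_iff le_refl permutes_in_image permutes_not_in)
    then have "\<sigma> (Suc b) = Suc b" using 0(1) by simp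
    then have "\<sigma> permutes {a..b}"
      by (intro permutes_superset[OF 0(2)]) (auto simp: le_Suc_eq)
    then have "\<sigma> \<in> gen ((\<lambda>i. transpose i (Suc i)) ` {a..<b})" by (rule Suc.IH)
    then show ?case using gen_mono[of _ "(\<lambda>i. transpose i (Suc i)) ` {a..<Suc b}"]
      by (meson image_mono ivl_subset le_SucI order_refl subsetD)
  next
    case (Suc n)
    let ?x = "\<sigma> (Suc b)"
    have "Suc b \<in> {a..Suc b}"
      using Suc(2,3) by (metis diff_self_eq_0 nat.distinct(1) permutes_not_in)
    then have "?x \<in> {a..Suc b}" using permutes_in_image[OF Suc(3)] by simp
    then have x: "?x \<in> {a..<Suc b}" using Suc(2) by auto
    let ?t = "transpose ?x (Suc ?x)"
    have "?t \<circ> \<sigma> permutes {a..Suc b}"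
      by (rule permutes_compose[OF Suc(3) permutes_swap_id]) (use x in auto)
    moreover have "n = Suc b - (?t \<circ> \<sigma>) (Suc b)" using Suc(2) by simp
    ultimately have "?t \<circ> \<sigma> \<in> gen ((\<lambda>i. transpose i (Suc i)) ` {a..<Suc b})"
      using Suc(1) by blast
    then have "?t \<circ> (?t \<circ> \<sigma>) \<in> gen ((\<lambda>i. transpose i (Suc i)) ` {a..<Suc b})"
      by (rule gen_step[rotated]) (use x in auto)
    moreover have "?t \<circ> (?t \<circ> \<sigma>) = \<sigma>" by (simp add: fun_eq_iff)
    ultimately show ?case by metis
  qed
qed

section \<open>The reflection exchanging the halves\<close>

definition delta :: "nat \<Rightarrow> nat \<Rightarrow> nat"
  where "delta m y = (if y \<in> {1..4 * m + 3} then 4 * m + 4 - y else y)"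

lemma delta_invol: "delta m \<circ> delta m = id"
  by (auto simp: delta_def fun_eq_iff)

lemma delta_permutes: "delta m permutes {1..4 * m + 3}"
  by (rule bij_imp_permutes_ext[OF o_bij[OF delta_invol delta_invol]]) (auto simp: delta_def)

lemma delta_image: "delta m ` {1..2 * m + 2} = {2 * m + 2..4 * m + 3}"
proof
  show "{2 * m + 2..4 * m + 3} \<subseteq> delta m ` {1..2 * m + 2}"
  proof
    fix y assume "y \<in> {2 * m + 2..4 * m + 3}"
    then have "delta m y \<in> {1..2 * m + 2}" "y = delta m (delta m y)" by (auto simp: delta_def)
    then show "y \<in> delta m ` {1..2 * m + 2}" by blast
  qed
qed (auto simp: delta_def)

section \<open>Halves with one family of rungs\<close>

lemma even_card_neq:
  assumes "finite {x. f x}" "finite {x. g x}"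
  shows "even (card {x. f x \<noteq> g x}) \<longleftrightarrow> (even (card {x. f x}) \<longleftrightarrow> even (card {x. g x}))"
proof -
  let ?F = "{x. f x}" and ?G = "{x. g x}"
  have "{x. f x \<noteq> g x} = (?F - ?G) \<union> (?G - ?F)" by auto
  then have "card {x. f x \<noteq> g x} = card (?F - ?G) + card (?G - ?F)"
    using card_Un_disjoint[of "?F - ?G" "?G - ?F"] assms by auto
  moreover have "card ?F = card (?F - ?G) + card (?F \<inter> ?G)"
    using assms by (metis card_Diff_subset_Int card_mono finite_Int inf_le1 le_add_diff_inverse2)
  moreover have "card ?G = card (?G - ?F) + card (?F \<inter> ?G)"
    using assms by (metis card_Diff_subset_Int card_mono finite_Int inf_le2 le_add_diff_inverse2 Int_commute)
  ultimately show ?thesis by presburger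
qed

lemma permutes_imp_le:
  fixes \<sigma> :: "nat \<Rightarrow> nat"
  assumes "\<sigma> permutes {i..j}"
  shows "x \<le> j \<Longrightarrow> \<sigma> x \<le> j" "i \<le> x \<Longrightarrow> i \<le> \<sigma> x" "x < i \<Longrightarrow> \<sigma> x = x" "j < x \<Longrightarrow> \<sigma> x = x"
proof -
  have *: "\<sigma> x \<in> {i..j} \<longleftrightarrow> x \<in> {i..j}" "x \<notin> {i..j} \<Longrightarrow> \<sigma> x = x"
    using permutes_in_image[OF assms] permutes_not_in[OF assms] by blast+
  show "x \<le> j \<Longrightarrow> \<sigma> x \<le> j" "i \<le> x \<Longrightarrow> i \<le> \<sigma> x" "x < i \<Longrightarrow> \<sigma> x = x" "j < x \<Longrightarrow> \<sigma> x = x"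
    using * by (cases "x \<in> {i..j}"; force)+
qed

text \<open>An even \<open>k\<close> makes the flip of the first \<open>k\<close> columns an even
  permutation. The value \<open>k = 0\<close> would leave the two rows unconnected.\<close>

locale rung_family =
  fixes k :: nat
  assumes even_k: "even k" and two_le_k: "2 \<le> k"
begin

abbreviation s :: "nat \<Rightarrow> nat \<Rightarrow> nat" where "s i \<equiv> transpose i (Suc i)"
definition u :: "nat \<Rightarrow> nat \<Rightarrow> bool" where "u i x \<longleftrightarrow> i = k \<and> x < k"
definition \<rho> :: "nat \<Rightarrow> nat \<Rightarrow> nat" where "\<rho> i = W (s i) (u i)"

lemma \<rho>_image: "\<rho> ` I = (\<lambda>i. W (s i) (u i)) ` I"
  by (simp add: \<rho>_def)

sublocale commuting_involutions \<rho>
proof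
  fix i j :: nat
  have "(s i \<circ> s i) = id" "(\<lambda>x. u i x \<noteq> u i (s i x)) = (\<lambda>_. False)"
    by (auto simp: u_def transpose_def)
  then show "\<rho> i \<circ> \<rho> i = id" unfolding \<rho>_def W_comp W_eq_id_iff by blast
  assume "i + 2 \<le> j"
  then show "\<rho> i \<circ> \<rho> j = \<rho> j \<circ> \<rho> i"
    unfolding \<rho>_def W_comp u_def by (intro W_eqI) (auto simp: transpose_def)
qed

lemma span_form:
  assumes "g \<in> span I"
  obtains \<sigma> f where "g = W \<sigma> f"
  using W_gen_form[of g s u I "\<lambda>_ _. True"] assms unfolding \<rho>_image by blast

lemma span_inv_pred:
  assumes "W \<sigma> f \<in> span I" "Q id (\<lambda>_. False)"
    and "\<And>i \<sigma> f. i \<in> I \<Longrightarrow> Q \<sigma> f \<Longrightarrow> Q (s i \<circ> \<sigma>) (\<lambda>x. f x \<noteq> (i = k \<and> \<sigma> x < k))"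
  shows "Q \<sigma> f"
proof (rule W_gen_inv[of \<sigma> f s u I, where Q = Q])
  show "W \<sigma> f \<in> gen ((\<lambda>i. W (s i) (u i)) ` I)" using assms(1) unfolding \<rho>_image .
qed (use assms(2,3) in \<open>simp_all add: u_def\<close>)

section \<open>Invariants of interval spans\<close>

lemma span_permutes: "W \<sigma> f \<in> span {i..<j} \<Longrightarrow> \<sigma> permutes {i..j}"
  by (erule span_inv_pred) (rule permutes_id, rule permutes_compose, assumption, rule permutes_swap_id, auto)

lemma span_above:
  assumes "W \<sigma> f \<in> span {i..<j}" "j < x" shows "\<not> f x"
proof -
  have "\<sigma> x = x \<and> \<not> f x"
    using assms(1) by (rule span_inv_pred) (use assms(2) in \<open>auto simp: transpose_def\<close>)
  then show ?thesis by simp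
qed

text \<open>Columns to the left of the interval are never permuted, and \<open>\<rho> k\<close> is
  the only generator that flips; if it occurs then \<open>i \<le> k\<close>, so it flips all of them
  together.\<close>

lemma span_below:
  assumes "W \<sigma> f \<in> span {i..<j}" shows "\<exists>e. \<forall>x<i. f x = e"
proof -
  have "(\<forall>x<i. \<sigma> x = x) \<and> (\<exists>e. \<forall>x<i. f x = e)"
    using assms
  proof (rule span_inv_pred)
    fix t :: nat and \<sigma> :: "nat \<Rightarrow> nat" and f :: "nat \<Rightarrow> bool"
    assume t: "t \<in> {i..<j}" and *: "(\<forall>x<i. \<sigma> x = x) \<and> (\<exists>e. \<forall>x<i. f x = e)"
    then obtain e where e: "\<forall>x<i. f x = e" by blast
    have "(f x \<noteq> (t = k \<and> \<sigma> x < k)) = (e \<noteq> (t = k)) \<and> (s t \<circ> \<sigma>) x = x" if "x < i" for x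
    proof -
      have "\<sigma> x = x" "f x = e" "x < t" using that * e t by simp_all
      then show ?thesis by (cases "t = k") simp_all
    qed
    then show "(\<forall>x<i. (s t \<circ> \<sigma>) x = x) \<and> (\<exists>e. \<forall>x<i. (f x \<noteq> (t = k \<and> \<sigma> x < k)) = e)"
      by (intro conjI exI[of _ "e \<noteq> (t = k)"] allI impI) simp_all
  qed auto
  then show ?thesis by blast
qed

lemma span_plain:
  assumes "W \<sigma> f \<in> span I" "k \<notin> I" shows "f = (\<lambda>_. False)"
  using assms(1) by (rule span_inv_pred) (use assms(2) in auto)

lemma span_ge:
  assumes "W \<sigma> f \<in> span {i..<j}" "k \<le> i" "k \<le> x" shows "\<not> f x"
proof -
  have "\<forall>x\<ge>k. k \<le> \<sigma> x \<and> \<not> f x"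
    using assms(1)
  proof (rule span_inv_pred)
    fix t :: nat and \<sigma> :: "nat \<Rightarrow> nat" and f :: "nat \<Rightarrow> bool"
    assume t: "t \<in> {i..<j}" and *: "\<forall>x\<ge>k. k \<le> \<sigma> x \<and> \<not> f x"
    have "k \<le> (s t \<circ> \<sigma>) x \<and> \<not> (f x \<noteq> (t = k \<and> \<sigma> x < k))" if "k \<le> x" for x
    proof -
      have "k \<le> \<sigma> x" "\<not> f x" "k \<le> t" using * that t assms(2) by auto
      then show ?thesis by (simp add: transpose_def)
    qed
    then show "\<forall>x\<ge>k. k \<le> (s t \<circ> \<sigma>) x \<and> \<not> (f x \<noteq> (t = k \<and> \<sigma> x < k))"
      by (intro allI impI)
  qed simp
  then show ?thesis using assms by simp
qed

text \<open>In an interval that ends with \<open>\<rho>\<^sub>k\<close>, renaming the rows of column \<open>k+1\<close> makes the flips constant.\<close>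

lemma span_last:
  assumes "W \<sigma> f \<in> span {i..<Suc k}"
  shows "\<exists>e. \<forall>x \<le> Suc k. f x = (e \<noteq> ((x = Suc k) \<noteq> (\<sigma> x = Suc k)))"
proof -
  have "(\<forall>x \<le> Suc k. \<sigma> x \<le> Suc k) \<and>
      (\<exists>e. \<forall>x \<le> Suc k. f x = (e \<noteq> ((x = Suc k) \<noteq> (\<sigma> x = Suc k))))"
    using assms
  proof (rule span_inv_pred)
    fix t :: nat and \<sigma> :: "nat \<Rightarrow> nat" and f :: "nat \<Rightarrow> bool"
    assume t: "t \<in> {i..<Suc k}" and *: "(\<forall>x \<le> Suc k. \<sigma> x \<le> Suc k) \<and>
      (\<exists>e. \<forall>x \<le> Suc k. f x = (e \<noteq> ((x = Suc k) \<noteq> (\<sigma> x = Suc k))))"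
    then obtain e where e: "\<forall>x \<le> Suc k. f x = (e \<noteq> ((x = Suc k) \<noteq> (\<sigma> x = Suc k)))" by blast
    have "(f x \<noteq> (t = k \<and> \<sigma> x < k)) = ((e \<noteq> (t = k)) \<noteq> ((x = Suc k) \<noteq> ((s t \<circ> \<sigma>) x = Suc k)))"
      if x: "x \<le> Suc k" for x
    proof -
      have "\<sigma> x \<le> Suc k" "f x = (e \<noteq> ((x = Suc k) \<noteq> (\<sigma> x = Suc k)))" using * e x by auto
      moreover have "t \<le> k" using t by auto
      moreover consider "\<sigma> x = Suc k" | "\<sigma> x = k" | "\<sigma> x < k" using calculation(1) by linarith
      ultimately show ?thesis by cases (auto simp: transpose_def)
    qed
    moreover have "\<forall>x \<le> Suc k. (s t \<circ> \<sigma>) x \<le> Suc k" using * t by (auto simp: transpose_def)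
    ultimately show "(\<forall>x \<le> Suc k. (s t \<circ> \<sigma>) x \<le> Suc k) \<and> (\<exists>e. \<forall>x \<le> Suc k.
        (f x \<noteq> (t = k \<and> \<sigma> x < k)) = (e \<noteq> ((x = Suc k) \<noteq> ((s t \<circ> \<sigma>) x = Suc k))))"
      by (intro conjI exI[of _ "e \<noteq> (t = k)"] allI impI) simp_all
  qed auto
  then show ?thesis by blast
qed

text \<open>Every use of \<open>\<rho> k\<close> toggles the flips on the preimage of the first
  \<open>k\<close> columns under a bijection, an even number of columns.\<close>

lemma span_even:
  assumes "W \<sigma> f \<in> span I" shows "finite {x. f x}" "even (card {x. f x})"
proof -
  have "bij \<sigma> \<and> finite {x. f x} \<and> even (card {x. f x})"
    using assms
  proof (rule span_inv_pred)
    fix i :: nat and \<sigma> :: "nat \<Rightarrow> nat" and f :: "nat \<Rightarrow> bool"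
    assume *: "bij \<sigma> \<and> finite {x. f x} \<and> even (card {x. f x})"
    have eq: "{x. i = k \<and> \<sigma> x < k} = (if i = k then \<sigma> -` {..<k} else {})" by auto
    have "finite {x. i = k \<and> \<sigma> x < k}"
      unfolding eq using * by (auto intro!: finite_vimageI bij_is_inj)
    moreover have "even (card {x. i = k \<and> \<sigma> x < k})"
      unfolding eq using * even_k card_vimage_inj[of \<sigma> "{..<k}"]
      by (auto simp: bij_is_inj bij_is_surj)
    moreover have "bij (s i \<circ> \<sigma>)" using * by (simp add: bij_comp)
    moreover have "finite {x. f x \<noteq> (i = k \<and> \<sigma> x < k)}"
      by (rule finite_subset[of _ "{x. f x} \<union> {x. i = k \<and> \<sigma> x < k}"]) (use * calculation in auto)
    ultimately show "bij (s i \<circ> \<sigma>) \<and> finite {x. f x \<noteq> (i = k \<and> \<sigma> x < k)} \<and>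
        even (card {x. f x \<noteq> (i = k \<and> \<sigma> x < k)})"
      using * even_card_neq[of f "\<lambda>x. i = k \<and> \<sigma> x < k"] by blast
  qed (use bij_id in \<open>simp add: id_def\<close>)
  then show "finite {x. f x}" "even (card {x. f x})" by auto
qed

section \<open>Row swaps contained in interval spans\<close>

lemma span_lift:
  assumes "\<sigma> permutes {a..b}"
  obtains f where "W \<sigma> f \<in> span {a..<b}"
proof -
  have "\<exists>f. W \<sigma> f \<in> span {a..<b}"
    using adjacent_transpositions_generate[OF assms]
  proof induction
    case gen_id
    show ?case using gen.gen_id W_id by metis
  next
    case (gen_step t \<sigma>)
    then obtain i f where i: "i \<in> {a..<b}" "t = s i" "W \<sigma> f \<in> span {a..<b}" by blast
    have "\<rho> i \<circ> W \<sigma> f \<in> span {a..<b}" using i by (intro gen.gen_step[OF _ i(3)]) auto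
    then show ?case unfolding \<rho>_def W_comp i(2) by blast
  qed
  then show ?thesis using that by blast
qed

lemma flip_if_mem: "(e \<Longrightarrow> W id f \<in> span I) \<Longrightarrow> W id (\<lambda>x. e \<and> f x) \<in> span I"
  by (cases e) (auto simp: W_id intro: gen_id)

text \<open>The product \<open>\<rho> k \<circ> \<rho> (Suc k)\<close> cycles the columns
  \<open>k\<close>, \<open>k + 1\<close>, \<open>k + 2\<close>. Its cube acts trivially on the
  columns, while the flip of the first \<open>k\<close> columns occurs an odd number of
  times.\<close>

lemma flip_below_mem:
  assumes "a \<le> k" "Suc k < b"
  shows "W id (\<lambda>x. x < k) \<in> span {a..<b}"
proof -
  let ?w = "\<rho> k \<circ> \<rho> (Suc k)"
  have "?w \<circ> (?w \<circ> ?w) = W id (\<lambda>x. x < k)"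
    unfolding \<rho>_def W_comp u_def by (intro W_eqI) (auto simp: transpose_def)
  moreover have "?w \<in> span {a..<b}" using assms by (intro gen_comp gen_base) auto
  ultimately show ?thesis using gen_comp by metis
qed

text \<open>In \<open>\<rho> (k - 1) \<circ> \<rho> k\<close> the columns \<open>k - 1\<close>,
  \<open>k\<close>, \<open>k + 1\<close> are cycled and each is flipped on exactly one of three
  steps. The columns further left are flipped three times, so the cube flips every column up to
  \<open>k + 1\<close> once.\<close>

lemma flip_all_mem:
  assumes "a < k"
  shows "W id (\<lambda>x. x \<le> Suc k) \<in> span {a..<Suc k}"
proof -
  obtain l where l: "k = Suc l" using assms by (cases k) auto
  let ?w = "\<rho> l \<circ> \<rho> (Suc l)"
  have "?w \<circ> (?w \<circ> ?w) = W id (\<lambda>x. x \<le> Suc k)"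
    unfolding \<rho>_def W_comp u_def using l by (intro W_eqI) (auto simp: transpose_def)
  moreover have "?w \<in> span {a..<Suc k}" using assms l by (intro gen_comp gen_base) auto
  ultimately show ?thesis using gen_comp by metis
qed

text \<open>The commutator of \<open>\<rho> (k - 1)\<close> with the flip of the first
  \<open>k\<close> columns flips exactly the columns \<open>k - 1\<close> and \<open>k\<close>;
  lifts of column permutations conjugate this pair to any other pair in the interval.\<close>

lemma flip_pair_mem:
  assumes "a < k" "Suc k < b" "x \<in> {a..b}" "y \<in> {a..b}" "x \<noteq> y"
  shows "W id (\<lambda>z. z = x \<or> z = y) \<in> span {a..<b}"
proof -
  obtain l where l: "k = Suc l" using assms by (cases k) auto
  let ?t = "W id (\<lambda>x. x < k)"
  have t: "?t \<in> span {a..<b}" using flip_below_mem assms by simp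
  have r: "\<rho> l \<in> span {a..<b}" using assms l by (intro gen_base) auto
  have "\<rho> l \<circ> (?t \<circ> (\<rho> l \<circ> ?t)) = W id (\<lambda>z. z = l \<or> z = k)"
    unfolding \<rho>_def W_comp u_def using l by (intro W_eqI) (auto simp: transpose_def)
  with gen_comp[OF r gen_comp[OF t gen_comp[OF r t]]]
  have p: "W id (\<lambda>z. z = l \<or> z = k) \<in> span {a..<b}" by simp
  \<comment> \<open>A permutation of \<open>{a..b}\<close> carrying \<open>l\<close> to
    \<open>x\<close> and \<open>k\<close> to \<open>y\<close>. The inner transposition settles
    \<open>l\<close>, the outer one corrects \<open>k\<close> without touching
    \<open>x\<close>.\<close>
  define \<sigma> where "\<sigma> = transpose (transpose l x k) y \<circ> transpose l x"
  have "l \<in> {a..b}" "k \<in> {a..b}" using assms l by auto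
  then have "\<sigma> permutes {a..b}"
    unfolding \<sigma>_def using assms by (intro permutes_compose permutes_swap_id) (auto simp: transpose_def)
  then obtain f where f: "W \<sigma> f \<in> span {a..<b}" by (rule span_lift)
  have \<sigma>: "\<sigma> l = x" "\<sigma> k = y" "inj \<sigma>"
    using assms(5) l by (auto simp: \<sigma>_def transpose_def intro: inj_compose)
  let ?g = "W \<sigma> f" and ?q = "W id (\<lambda>z. z = x \<or> z = y)"
  have eq: "?q \<circ> ?g = ?g \<circ> W id (\<lambda>z. z = l \<or> z = k)"
    unfolding W_comp W_eq_iff using \<sigma> by (auto simp: fun_eq_iff inj_eq)
  have "?q = (?q \<circ> ?g) \<circ> inv' ?g"
    unfolding comp_assoc bij_cancel(2)[OF span_bij[OF f]] by simp
  also have "\<dots> \<in> span {a..<b}"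
    unfolding eq by (rule gen_comp[OF gen_comp[OF f p] span_inv[OF f]])
  finally show ?thesis .
qed

lemma flip_mem:
  assumes ab: "a < k" "Suc k < b" and F: "finite {x. f x}" "even (card {x. f x})"
    and below: "\<forall>x<a. f x = e" and above: "\<And>x. b < x \<Longrightarrow> \<not> f x"
  shows "W id f \<in> span {a..<b}"
proof -
  have sets: "W id (\<lambda>x. x \<in> A) \<in> span {a..<b}" if "finite A" "even (card A)" "A \<subseteq> {a..b}" for A
    using that
  proof (induction "card A" arbitrary: A rule: less_induct)
    case less
    show ?case
    proof (cases "A = {}")
      case True
      then have "(\<lambda>x. x \<in> A) = (\<lambda>_. False)" by simp
      then show ?thesis using gen_id W_id by metis
    next
      case False
      then obtain x where x: "x \<in> A" by blast
      have "A \<noteq> {x}" using less.prems(2) by auto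
      then obtain y where y: "y \<in> A" "y \<noteq> x" using x by blast
      let ?B = "A - {x, y}"
      have "card ?B = card A - card {x, y}" using x y by (intro card_Diff_subset) auto
      moreover have "card {x, y} \<le> card A" using x y less.prems(1) by (intro card_mono) auto
      ultimately have c: "card A = card ?B + 2" using y(2) by simp
      have p: "W id (\<lambda>z. z \<in> ?B) \<in> span {a..<b}"
        using less.hyps[of ?B] less.prems c by auto
      have q: "W id (\<lambda>z. z = x \<or> z = y) \<in> span {a..<b}"
        using x y less.prems(3) by (intro flip_pair_mem[OF ab]) auto
      have eq: "W id (\<lambda>z. z = x \<or> z = y) \<circ> W id (\<lambda>z. z \<in> ?B) = W id (\<lambda>z. z \<in> A)"
        unfolding W_comp W_eq_iff using x y by auto
      show ?thesis using gen_comp[OF q p] unfolding eq .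
    qed
  qed
  \<comment> \<open>If the columns below \<open>a\<close> are flipped, the flip of the first
    \<open>k\<close> columns clears them. As \<open>k\<close> is even, an even set inside
    \<open>{a..b}\<close> remains, which is a union of pairs.\<close>
  define f' where "f' x = (f x \<noteq> (e \<and> x < k))" for x
  have fin: "finite {x. e \<and> x < k}" by simp
  have ev: "even (card {x. e \<and> x < k})" using even_k by (cases e) (simp_all add: lessThan_def[symmetric])
  have "{x. f' x} \<subseteq> {a..b}"
  proof
    fix x assume x: "x \<in> {x. f' x}"
    have "\<not> x < a" using x below ab by (auto simp: f'_def)
    moreover have "\<not> b < x" using x above[of x] ab by (auto simp: f'_def)
    ultimately show "x \<in> {a..b}" by simp
  qed
  moreover have "even (card {x. f' x})"
    unfolding f'_def using even_card_neq[OF F(1) fin] F(2) ev by simp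
  moreover have "finite {x. f' x}" using calculation(1) finite_subset by blast
  ultimately have m: "W id f' \<in> span {a..<b}" using sets[of "{x. f' x}"] by simp
  have t: "W id (\<lambda>x. e \<and> x < k) \<in> span {a..<b}"
    using flip_below_mem[of a b] ab by (intro flip_if_mem) simp
  have "W id f = W id (\<lambda>x. e \<and> x < k) \<circ> W id f'"
    unfolding W_comp W_eq_iff f'_def by auto
  then show ?thesis using gen_comp[OF t m] by simp
qed

text \<open>Division by a lift of the column permutation leaves a pure flip \<open>f1\<close>. If
  \<open>\<rho> (Suc k)\<close> is present, every admissible even pattern is available. If the
  interval ends with \<open>\<rho> k\<close>, \<open>span_last\<close> leaves only the constant
  pattern, which \<open>flip_all_mem\<close> supplies. The same argument serves the interval
  condition and \<open>detached\<close>.\<close>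

lemma span_descend:
  assumes g: "W \<sigma> f \<in> span {i..<b}" and \<sigma>: "\<sigma> permutes {Suc i..b}"
    and below: "\<forall>x<Suc i. f x = e" and k: "Suc i < k" "k < b"
  shows "W \<sigma> f \<in> span {Suc i..<b}"
proof -
  obtain f0 where f0: "W (inv' \<sigma>) f0 \<in> span {Suc i..<b}"
    using span_lift[OF permutes_inv[OF \<sigma>]] .
  let ?h = "W (inv' \<sigma>) f0"
  define f1 where "f1 x = (f x \<noteq> f0 (\<sigma> x))" for x
  have h: "?h \<circ> W \<sigma> f = W id f1"
    unfolding W_comp f1_def using permutes_inv_o(2)[OF \<sigma>] by simp
  have mem: "W id f1 \<in> span {i..<b}"
    unfolding h[symmetric] by (rule gen_comp[OF span_monoD[OF f0] g]) auto
  obtain e0 where e0: "\<forall>x<Suc i. f0 x = e0" using span_below[OF f0] by blast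
  have e: "\<forall>x<Suc i. f1 x = (e \<noteq> e0)"
    using below e0 permutes_imp_le(3)[OF \<sigma>] by (auto simp: f1_def)
  have "W id f1 \<in> span {Suc i..<b}"
  proof (cases "b = Suc k")
    case False
    then show ?thesis
      using flip_mem[OF k(1) _ span_even[OF mem] e span_above[OF mem]] k by simp
  next
    case True
    then obtain e1 where e1: "\<forall>x \<le> Suc k. f1 x = e1" using span_last[of id f1 i] mem by auto
    then have "f1 = (\<lambda>x. e1 \<and> x \<le> Suc k)"
      using span_above[OF mem] True by (auto simp: fun_eq_iff not_le[symmetric])
    moreover have "W id (\<lambda>x. e1 \<and> x \<le> Suc k) \<in> span {Suc i..<b}"
      using flip_all_mem[OF k(1)] True by (intro flip_if_mem) simp
    ultimately show ?thesis by simp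
  qed
  moreover have "W \<sigma> f = inv' ?h \<circ> W id f1"
    unfolding h[symmetric] using span_bij[OF f0] by (simp only: bij_cancel)
  ultimately show ?thesis using gen_comp[OF span_inv[OF f0]] by simp
qed

sublocale interval_intersection \<rho> r for r
proof
  fix i j :: nat assume ij: "i < j"
  show "span {i..<j} \<inter> span {Suc i..<Suc j} \<subseteq> span {Suc i..<j}"
  proof
    fix g assume "g \<in> span {i..<j} \<inter> span {Suc i..<Suc j}"
    then have g: "g \<in> span {i..<j}" "g \<in> span {Suc i..<Suc j}" by auto
    obtain \<sigma> f where gW: "g = W \<sigma> f" using g by (elim span_form)
    note g = g[unfolded gW]
    have \<sigma>1: "\<sigma> permutes {i..j}" and \<sigma>2: "\<sigma> permutes {Suc i..Suc j}"
      using g span_permutes by auto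
    have "\<sigma> x = x" if "x \<in> {i..j} - {Suc i..j}" for x
      using that permutes_imp_le(3)[OF \<sigma>2, of x] by auto
    then have \<sigma>: "\<sigma> permutes {Suc i..j}" by (rule permutes_superset[OF \<sigma>1])
    obtain e where e: "\<forall>x<Suc i. f x = e" using span_below[OF g(2)] by blast
    consider "k \<notin> {Suc i..<j}" | "Suc i < k" "k < j" | "k = Suc i" "k < j" by force
    then have "W \<sigma> f \<in> span {Suc i..<j}"
    proof cases
      case 1
      \<comment> \<open>An index outside the common part is missing from at least one of the two
        intervals, and without \<open>\<rho> k\<close> nothing is flipped.\<close>
      then have "k \<notin> {i..<j} \<or> k \<notin> {Suc i..<Suc j}" using ij by auto
      then have f: "f = (\<lambda>_. False)" using g span_plain by blast
      obtain f0 where f0: "W \<sigma> f0 \<in> span {Suc i..<j}" using span_lift[OF \<sigma>] .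
      then show ?thesis using span_plain[OF f0 1] f by simp
    next
      case 2
      then show ?thesis using span_descend[OF g(1) \<sigma> e] by simp
    next
      case 3
      \<comment> \<open>Here the common interval begins with \<open>\<rho> k\<close>, so single
        pairs cannot be flipped. The bounds \<open>span_below\<close> and \<open>span_ge\<close>
        from the second interval leave only the joint flip of the first \<open>k\<close>
        columns.\<close>
      obtain f0 where f0: "W (inv' \<sigma>) f0 \<in> span {Suc i..<j}"
        using span_lift[OF permutes_inv[OF \<sigma>]] .
      let ?h = "W (inv' \<sigma>) f0"
      define f1 where "f1 x = (f x \<noteq> f0 (\<sigma> x))" for x
      have h: "?h \<circ> W \<sigma> f = W id f1"
        unfolding W_comp f1_def using permutes_inv_o(2)[OF \<sigma>] by simp
      have mem: "W id f1 \<in> span {i..<j}" "W id f1 \<in> span {Suc i..<Suc j}"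
        unfolding h[symmetric]
        by (rule gen_comp[OF span_monoD[OF f0] g(1)], force, rule gen_comp[OF span_monoD[OF f0] g(2)], force)
      obtain e1 where "\<forall>x<Suc i. f1 x = e1" using span_below[OF mem(2)] by blast
      moreover have "\<not> f1 x" if "k \<le> x" for x using span_ge[OF mem(2) _ that] 3 by simp
      ultimately have f1: "f1 = (\<lambda>x. e1 \<and> x < k)" using 3 by (auto simp: fun_eq_iff not_less[symmetric])
      have "W id f1 \<in> span {Suc i..<j}"
      proof (cases "j = Suc k")
        case False
        then show ?thesis
          unfolding f1 using flip_below_mem[of "Suc i" j] 3 by (intro flip_if_mem) simp
      next
        case True
        \<comment> \<open>The common interval is now \<open>\<rho> k\<close> alone, which does not
          contain the joint flip. The first interval excludes it: there the pattern is constant up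
          to column \<open>k + 1\<close>, while the joint flip differs at columns \<open>0\<close>
          and \<open>k\<close>.\<close>
        then obtain e2 where "\<forall>x \<le> Suc k. f1 x = e2" using span_last[of id f1 i] mem by auto
        then have "f1 0 = f1 k" by simp
        then have "f1 = (\<lambda>_. False)" using f1 3 by auto
        then show ?thesis using gen_id W_id by metis
      qed
      moreover have "W \<sigma> f = inv' ?h \<circ> W id f1"
        unfolding h[symmetric] using span_bij[OF f0] by (simp only: bij_cancel)
      ultimately show ?thesis using gen_comp[OF span_inv[OF f0]] by simp
    qed
    then show "g \<in> span {Suc i..<j}" using gW by simp
  qed
qed

lemma \<rho>_pt: "\<rho> i (pt x b) = pt (s i x) (b \<noteq> (i = k \<and> x < k))"
  by (simp add: \<rho>_def u_def)

theorem half_system_rung: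
  assumes km: "k < m"
  shows "half_system \<rho> m {1..2 * m + 2} (pt m True)"
proof
  show "finite {1..2 * m + 2}" "2 \<le> m" using km two_le_k by auto
  fix i
  have bij: "bij (\<rho> i)" using invol[of i] by (rule o_bij[OF _ invol])
  { assume i: "i < m"
    show "\<rho> i permutes {1..2 * m + 2}"
      using bij i unfolding \<rho>_def by (intro W_permutes) (auto simp: u_def transpose_def)
    show "evenperm (\<rho> i)"
    proof (cases "i = k")
      case False
      then have "u i = (\<lambda>_. False)" by (simp add: u_def fun_eq_iff)
      then show ?thesis unfolding \<rho>_def using even_W_transpose by simp
    next
      case True
      have eq: "\<rho> i = W id (\<lambda>x. x < k) \<circ> W (s i) (\<lambda>_. False)"
        unfolding \<rho>_def W_comp W_eq_iff by (auto simp: True u_def transpose_def)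
      have p: "permutation (W id (\<lambda>x. x < k))" "permutation (W (s i) (\<lambda>_. False))"
        by (rule permutation_W[of _ _ k], rule bij_W_involution; simp)
          (rule permutation_W[of _ _ "Suc i"], rule bij_W_involution; simp)
      show ?thesis
        unfolding eq evenperm_comp[OF p] using even_W_transpose even_W_flip_below[OF even_k] by simp
    qed
    show "\<rho> i \<noteq> id"
    proof
      assume "\<rho> i = id"
      then show False using \<rho>_pt[of i i True] by simp
    qed }
  show "\<rho> i (pt m True) = pt m True" if "Suc i < m" using that km by (simp add: \<rho>_pt)
  show "\<rho> (m - 1) (pt m True) \<noteq> pt m True"
    using km by (simp add: \<rho>_pt transpose_def)
  let ?R = "(\<lambda>g. g (pt m True)) ` span {..<m}"
  have step: "\<rho> i y \<in> ?R" if "y \<in> ?R" "i < m" for i y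
    using that by (auto intro!: image_eqI[of _ _ "\<rho> i \<circ> g" for g] gen_step)
  have up: "pt x True \<in> ?R" if "x \<le> m" for x
    using that
  proof (induction rule: inc_induct)
    case base
    show ?case by (rule image_eqI[OF _ gen_id]) simp
  next
    case (step x)
    then show ?case using \<open>\<And>i y. y \<in> ?R \<Longrightarrow> i < m \<Longrightarrow> \<rho> i y \<in> ?R\<close>[of "pt (Suc x) True" x]
      by (auto simp: \<rho>_pt)
  qed
  have down: "pt x False \<in> ?R" if "x \<le> m" for x
    using that
  proof (induction x)
    case 0
    \<comment> \<open>The crossing between the rows: the upper row is followed down to column 0,
      \<open>\<rho> k\<close> changes the row there, and the lower row is followed back up.\<close>
    have "\<rho> k (pt 0 True) = pt 0 False" using two_le_k by (simp add: \<rho>_pt)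
    then show ?case using step[OF up[of 0] km] by simp
  next
    case (Suc x)
    then show ?case using step[of "pt x False" x] by (auto simp: \<rho>_pt)
  qed
  show "{1..2 * m + 2} \<subseteq> ?R"
  proof
    fix y assume y: "y \<in> {1..2 * m + 2}"
    show "y \<in> ?R"
    proof (cases y rule: pt_cases)
      case (2 x b)
      then have "x \<le> m" using y pt_mem_iff by metis
      then show ?thesis using up down 2 by (cases b) simp_all
    qed (use y in auto)
  qed
  fix g
  assume i: "Suc i < m" and g: "g \<in> span {i..<m}"
    and fixd: "\<And>x. x \<notin> (\<lambda>h. h (pt m True)) ` span {Suc i..<m} \<Longrightarrow> g x = x"
  obtain \<sigma> f where gW: "g = W \<sigma> f" using g by (elim span_form)
  have orbit: "\<exists>\<tau> f'. W \<tau> f' \<in> span {Suc i..<m} \<and> pt x b = pt (\<tau> m) (\<not> f' m)"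
    if "pt x b \<in> (\<lambda>h. h (pt m True)) ` span {Suc i..<m}" for x b
  proof -
    from that obtain h where h: "h \<in> span {Suc i..<m}" "pt x b = h (pt m True)" by blast
    then obtain \<tau> f' where "h = W \<tau> f'" by (elim span_form)
    then show ?thesis using h by auto
  qed
  show "g \<in> span {Suc i..<m}"
  proof (cases "Suc i < k")
    case False
    \<comment> \<open>For \<open>k \<le> Suc i\<close> the column \<open>m\<close> is never flipped,
      so the orbit of \<open>c\<close> stays in the upper row. Then \<open>g\<close> fixes the whole
      lower row, hence every column, and flips none.\<close>
    have "g (pt x False) = pt x False" for x
    proof (rule fixd, rule notI)
      assume "pt x False \<in> (\<lambda>h. h (pt m True)) ` span {Suc i..<m}"
      from orbit[OF this] obtain \<tau> f' where "W \<tau> f' \<in> span {Suc i..<m}" "f' m"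
        by (elim exE conjE) simp
      then show False using span_ge[of \<tau> f' "Suc i" m m] False km by simp
    qed
    then have "\<sigma> = id \<and> f = (\<lambda>_. False)" unfolding gW by (auto simp: fun_eq_iff)
    then show ?thesis unfolding gW using gen_id W_id by metis
  next
    case True
    \<comment> \<open>The orbit of \<open>c\<close> uses only columns from \<open>Suc i\<close> on.
      Hence \<open>g\<close> fixes the columns up to \<open>i\<close> without a flip, which is what
      \<open>span_descend\<close> requires.\<close>
    have low: "g (pt x False) = pt x False" if "x \<le> i" for x
    proof (rule fixd, rule notI)
      assume "pt x False \<in> (\<lambda>h. h (pt m True)) ` span {Suc i..<m}"
      from orbit[OF this] obtain \<tau> f' where \<tau>: "W \<tau> f' \<in> span {Suc i..<m}" "x = \<tau> m"
        by (elim exE conjE) simp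
      then have "Suc i \<le> \<tau> m" using permutes_imp_le(2)[OF span_permutes[OF \<tau>(1)], of m] i by simp
      then show False using \<tau>(2) that by simp
    qed
    have \<sigma>: "\<sigma> permutes {Suc i..m}"
      by (rule permutes_superset[OF span_permutes[OF g[unfolded gW]]]) (use low gW in auto)
    show ?thesis
      unfolding gW by (rule span_descend[OF g[unfolded gW] \<sigma> _ True km]) (use low gW in auto)
  qed
qed

end

section \<open>Halves with a corner\<close>

locale corner_family =
  fixes twisted :: bool
begin

text \<open>Only the first generator flips, in columns 0 and 1. The extra swap of these columns in
  \<open>s 2\<close> commutes with it and connects column 0 even in the untwisted case, where
  \<open>s 0\<close> moves no column.\<close>

definition s :: "nat \<Rightarrow> nat \<Rightarrow> nat" where
  "s i = (if i = 0 then if twisted then transpose 0 1 else id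
    else if i = 2 then transpose 0 1 \<circ> transpose 2 3 else transpose i (Suc i))"
definition u :: "nat \<Rightarrow> nat \<Rightarrow> bool" where "u i x \<longleftrightarrow> i = 0 \<and> x < 2"
definition \<rho> :: "nat \<Rightarrow> nat \<Rightarrow> nat" where "\<rho> i = W (s i) (u i)"

abbreviation P :: "(nat \<Rightarrow> nat) \<Rightarrow> nat \<Rightarrow> nat" where "P \<sigma> \<equiv> W \<sigma> (\<lambda>_. False)"

lemma P_comp: "P \<sigma> \<circ> P \<tau> = P (\<sigma> \<circ> \<tau>)"
  by (simp add: W_comp)

lemma s_s: "s i (s i x) = x"
  by (auto simp: s_def transpose_def)

lemma s_comm: "i + 2 \<le> j \<Longrightarrow> s i (s j x) = s j (s i x)"
  by (auto simp: s_def transpose_def)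

lemma s_less_2:
  assumes "2 \<le> i \<or> i = 0" shows "s i x < 2 \<longleftrightarrow> x < 2"
proof -
  consider "i = 0" | "i = 2" | "3 \<le> i" using assms by linarith
  then show ?thesis
  proof cases
    case 3
    then have "s i x = transpose i (Suc i) x" by (simp add: s_def)
    then show ?thesis using 3 by (simp add: transpose_def)
  qed (simp_all add: s_def transpose_def)
qed

lemma s_above: "i < j \<Longrightarrow> j < x \<Longrightarrow> s i x = x"
  by (auto simp: s_def transpose_def)

lemma \<rho>_image: "\<rho> ` I = (\<lambda>i. W (s i) (u i)) ` I"
  by (simp add: \<rho>_def)

lemma \<rho>_plain: "0 < i \<Longrightarrow> \<rho> i = P (s i)"
  unfolding \<rho>_def by (rule W_eqI) (simp_all add: u_def)

sublocale commuting_involutions \<rho>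
proof
  fix i j :: nat
  have "s i \<circ> s i = id" by (simp add: fun_eq_iff s_s)
  moreover have "(\<lambda>x. u i x \<noteq> u i (s i x)) = (\<lambda>_. False)"
    using s_less_2[of i] by (auto simp: u_def)
  ultimately show "\<rho> i \<circ> \<rho> i = id" unfolding \<rho>_def W_comp W_eq_id_iff by blast
  assume ij: "i + 2 \<le> j"
  show "\<rho> i \<circ> \<rho> j = \<rho> j \<circ> \<rho> i"
    unfolding \<rho>_def W_comp by (rule W_eqI) (use s_comm[OF ij] s_less_2[of j] ij in \<open>auto simp: u_def\<close>)
qed

lemma span_form:
  assumes "g \<in> span I"
  obtains \<sigma> f where "g = W \<sigma> f"
  using W_gen_form[of g s u I "\<lambda>_ _. True"] assms unfolding \<rho>_image by blast

lemma span_inv_pred: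
  assumes "W \<sigma> f \<in> span I" "Q id (\<lambda>_. False)"
    and "\<And>i \<sigma> f. i \<in> I \<Longrightarrow> Q \<sigma> f \<Longrightarrow> Q (s i \<circ> \<sigma>) (\<lambda>x. f x \<noteq> u i (\<sigma> x))"
  shows "Q \<sigma> f"
proof (rule W_gen_inv[of \<sigma> f s u I, where Q = Q])
  show "W \<sigma> f \<in> gen ((\<lambda>i. W (s i) (u i)) ` I)" using assms(1) unfolding \<rho>_image .
qed (use assms(2,3) in simp_all)

lemma bij_s: "bij (s i)"
  by (rule o_bij[of "s i" "s i"]) (simp_all add: fun_eq_iff s_s)

lemma span_bij_left: "W \<sigma> f \<in> span I \<Longrightarrow> bij \<sigma>"
  by (erule span_inv_pred) (rule bij_id, rule bij_comp[OF _ bij_s])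

lemma span_above:
  assumes "W \<sigma> f \<in> span {i..<j}" "0 < j" "j < x"
  shows "\<sigma> x = x" "\<not> f x"
proof -
  have "\<forall>x>j. \<sigma> x = x \<and> \<not> f x"
    using assms(1)
  proof (rule span_inv_pred)
    fix t :: nat and \<sigma> :: "nat \<Rightarrow> nat" and f :: "nat \<Rightarrow> bool"
    assume t: "t \<in> {i..<j}" and *: "\<forall>x>j. \<sigma> x = x \<and> \<not> f x"
    have "(s t \<circ> \<sigma>) x = x \<and> \<not> (f x \<noteq> u t (\<sigma> x))" if "j < x" for x
      using * t that s_above[of t j x] assms(2) by (simp add: u_def)
    then show "\<forall>x>j. (s t \<circ> \<sigma>) x = x \<and> \<not> (f x \<noteq> u t (\<sigma> x))" by (intro allI impI)
  qed simp
  then show "\<sigma> x = x" "\<not> f x" using assms(3) by auto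
qed

lemma span_plain:
  assumes "W \<sigma> f \<in> span I" "0 \<notin> I" shows "f = (\<lambda>_. False)"
proof -
  have "\<forall>x. \<not> f x"
    using assms(1)
  proof (rule span_inv_pred)
    fix t :: nat and \<sigma> :: "nat \<Rightarrow> nat" and f :: "nat \<Rightarrow> bool"
    assume "t \<in> I" "\<forall>x. \<not> f x"
    then show "\<forall>x. \<not> (f x \<noteq> u t (\<sigma> x))" using assms(2) by (auto simp: u_def)
  qed simp
  then show ?thesis by auto
qed

lemma span_permutes:
  assumes "W \<sigma> f \<in> span {i..<j}" "3 \<le> i \<or> i = 1 \<and> j = 2"
  shows "\<sigma> permutes {i..j}"
  using assms(1)
proof (rule span_inv_pred)
  fix t :: nat and \<sigma> :: "nat \<Rightarrow> nat" and f :: "nat \<Rightarrow> bool"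
  assume t: "t \<in> {i..<j}" and \<sigma>: "\<sigma> permutes {i..j}"
  have "s t = transpose t (Suc t)" using t assms(2) by (auto simp: s_def)
  then have "s t permutes {i..j}" using t by (auto intro: permutes_swap_id)
  then show "s t \<circ> \<sigma> permutes {i..j}" by (rule permutes_compose[OF \<sigma>])
qed (rule permutes_id)

lemma span_less_2:
  assumes "W \<sigma> f \<in> span {2..<j}" shows "\<sigma> x < 2 \<longleftrightarrow> x < 2"
proof -
  have "\<forall>x. \<sigma> x < 2 \<longleftrightarrow> x < 2"
    using assms by (rule span_inv_pred) (simp_all add: s_less_2)
  then show ?thesis by blast
qed

text \<open>For bijections fixing all columns above 3: the symmetries of the square with diagonals
  \<open>{0, 3}\<close> and \<open>{1, 2}\<close>. Here \<open>s 1\<close> is a reflection in a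
  diagonal and \<open>s 2\<close> a reflection through midpoints of sides.\<close>

definition dihedral :: "(nat \<Rightarrow> nat) \<Rightarrow> bool"
  where "dihedral \<sigma> \<longleftrightarrow> (\<forall>x\<le>3. \<sigma> x \<le> 3 \<and> \<sigma> (3 - x) = 3 - \<sigma> x)"

lemma le_3_cases:
  assumes "x \<le> (3::nat)" obtains "x = 0" | "x = 1" | "x = 2" | "x = 3"
  using assms by linarith

lemma s_dihedral:
  assumes "t = 1 \<or> t = 2" "x \<le> 3"
  shows "s t x \<le> 3 \<and> s t (3 - x) = 3 - s t x"
  using assms(2,1) by (cases rule: le_3_cases) (auto simp: s_def transpose_def)

lemma dihedral_step: "t = 1 \<or> t = 2 \<Longrightarrow> dihedral \<sigma> \<Longrightarrow> dihedral (s t \<circ> \<sigma>)"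
  unfolding dihedral_def using s_dihedral by simp

lemma span_dihedral:
  assumes "W \<sigma> f \<in> span {1..<3}" shows "dihedral \<sigma>"
  using assms
proof (rule span_inv_pred)
  fix t :: nat and \<sigma> :: "nat \<Rightarrow> nat"
  assume "t \<in> {1..<3}" "dihedral \<sigma>"
  moreover from this have "t = 1 \<or> t = 2" by auto
  ultimately show "dihedral (s t \<circ> \<sigma>)" by (intro dihedral_step)
qed (simp add: dihedral_def)

lemma s_cube:
  assumes "t \<le> 2" "p \<le> 3" "q \<le> 3" "p \<noteq> q"
  shows "(twisted \<and> (u t p \<noteq> u t q)) = ((s t p + s t q = 3) \<noteq> (p + q = 3))"
proof -
  have "t = 0 \<or> t = 1 \<or> t = 2" using assms(1) by auto
  then show ?thesis
    using assms(2) assms(3,4)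
    by (elim le_3_cases[of p] le_3_cases[of q] disjE) (simp_all add: s_def u_def transpose_def)
qed

lemma s_le_3: "t \<le> 2 \<Longrightarrow> p \<le> 3 \<Longrightarrow> s t p \<le> 3"
  by (auto simp: s_def transpose_def)

text \<open>The invariant says, in the twisted case, that \<open>\<langle>\<rho>\<^sub>0, \<rho>\<^sub>1, \<rho>\<^sub>2\<rangle>\<close> preserves the graph of a cube whose
  pairs of antipodal vertices are the first four columns and in which the rows are opposite faces;
  in the untwisted case it acts dihedrally on these columns.\<close>

lemma span_cube:
  assumes "W \<sigma> f \<in> span {0..<3}" "x \<le> 3" "y \<le> 3" "x \<noteq> y"
  shows "\<sigma> x \<le> 3" "(twisted \<and> (f x \<noteq> f y)) = ((\<sigma> x + \<sigma> y = 3) \<noteq> (x + y = 3))"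
proof -
  define Q where "Q \<sigma> f \<longleftrightarrow> inj \<sigma> \<and> (\<forall>x\<le>3. \<sigma> x \<le> 3) \<and> (\<forall>x\<le>3. \<forall>y\<le>3. x \<noteq> y \<longrightarrow>
    (twisted \<and> (f x \<noteq> f y)) = ((\<sigma> x + \<sigma> y = 3) \<noteq> (x + y = 3)))"
    for \<sigma> :: "nat \<Rightarrow> nat" and f :: "nat \<Rightarrow> bool"
  have "Q \<sigma> f"
    using assms(1)
  proof (rule span_inv_pred)
    fix t :: nat and \<sigma> :: "nat \<Rightarrow> nat" and f :: "nat \<Rightarrow> bool"
    assume t: "t \<in> {0..<3}" and Q: "Q \<sigma> f"
    have t2: "t \<le> 2" using t by auto
    have inj: "inj \<sigma>" and le: "\<And>x. x \<le> 3 \<Longrightarrow> \<sigma> x \<le> 3" using Q by (auto simp: Q_def)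
    have "(twisted \<and> ((f x \<noteq> u t (\<sigma> x)) \<noteq> (f y \<noteq> u t (\<sigma> y)))) =
        (((s t \<circ> \<sigma>) x + (s t \<circ> \<sigma>) y = 3) \<noteq> (x + y = 3))"
      if x: "x \<le> 3" and y: "y \<le> 3" and xy: "x \<noteq> y" for x y
    proof -
      have "\<sigma> x \<noteq> \<sigma> y" using inj xy by (simp add: inj_eq)
      then have 1: "(twisted \<and> (u t (\<sigma> x) \<noteq> u t (\<sigma> y))) =
          ((s t (\<sigma> x) + s t (\<sigma> y) = 3) \<noteq> (\<sigma> x + \<sigma> y = 3))"
        by (rule s_cube[OF t2 le[OF x] le[OF y]])
      have 2: "(twisted \<and> (f x \<noteq> f y)) = ((\<sigma> x + \<sigma> y = 3) \<noteq> (x + y = 3))"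
        using Q x y xy unfolding Q_def by blast
      show ?thesis
        using 1 2 unfolding comp_apply by argo
    qed
    moreover have "inj (s t \<circ> \<sigma>)" using inj bij_s bij_is_inj inj_compose by blast
    ultimately show "Q (s t \<circ> \<sigma>) (\<lambda>x. f x \<noteq> u t (\<sigma> x))"
      unfolding Q_def using le s_le_3[OF t2] by simp
  qed (simp add: Q_def)
  then show "\<sigma> x \<le> 3" "(twisted \<and> (f x \<noteq> f y)) = ((\<sigma> x + \<sigma> y = 3) \<noteq> (x + y = 3))"
    using assms unfolding Q_def by blast+
qed

section \<open>Column permutations contained in the spans\<close>

lemma plain_mem_of_gen:
  assumes "g \<in> gen T" "\<And>t. t \<in> T \<Longrightarrow> P t \<in> span I"
  shows "P g \<in> span I"
  using assms(1)
proof induction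
  case gen_id
  show ?case using gen.gen_id W_id by metis
next
  case (gen_step t g)
  show ?case using gen_comp[OF assms(2)[OF gen_step(1)] gen_step(3)] by (simp only: P_comp)
qed

lemma plain_mem_of_permutes:
  assumes "\<sigma> permutes {a..b}" "\<And>i. a \<le> i \<Longrightarrow> i < b \<Longrightarrow> P (transpose i (Suc i)) \<in> span I"
  shows "P \<sigma> \<in> span I"
  by (rule plain_mem_of_gen[OF adjacent_transpositions_generate[OF assms(1)]]) (use assms(2) in auto)

lemma plain_adjacent:
  assumes "i \<in> I" "i = 1 \<or> 3 \<le> i" shows "P (transpose i (Suc i)) \<in> span I"
proof -
  have "P (transpose i (Suc i)) = \<rho> i" using assms(2) by (auto simp: \<rho>_plain s_def)
  then show ?thesis using assms(1) by (simp add: gen_base)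
qed

text \<open>\<open>s 2 \<circ> s 3\<close> is the swap of 0 and 1 times a 3-cycle on 2, 3, 4, so its
  cube isolates the swap. Intervals with \<open>\<rho> 2\<close> but without \<open>\<rho> 3\<close>
  therefore need separate treatment.\<close>

lemma plain_01:
  assumes "2 \<in> I" "3 \<in> I" shows "P (transpose 0 1) \<in> span I"
proof -
  let ?w = "\<rho> 2 \<circ> \<rho> 3"
  have "s 2 \<circ> s 3 \<circ> (s 2 \<circ> s 3 \<circ> (s 2 \<circ> s 3)) = transpose 0 1"
    by (rule ext) (auto simp: s_def transpose_def)
  then have eq: "?w \<circ> (?w \<circ> ?w) = P (transpose 0 1)" by (simp add: \<rho>_plain P_comp del: o_apply)
  have "?w \<in> span I" using assms by (intro gen_comp gen_base) auto
  from gen_comp[OF this gen_comp[OF this this]] show ?thesis unfolding eq .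
qed

lemma plain_23:
  assumes "2 \<in> I" "3 \<in> I" shows "P (transpose 2 3) \<in> span I"
proof -
  have "transpose 0 1 \<circ> s 2 = transpose 2 (3::nat)" by (rule ext) (auto simp: s_def transpose_def)
  then have "P (transpose 0 1) \<circ> \<rho> 2 = P (transpose 2 3)" by (simp add: \<rho>_plain P_comp)
  moreover have "P (transpose 0 1) \<circ> \<rho> 2 \<in> span I"
    using assms by (intro gen_comp[OF plain_01] gen_base) auto
  ultimately show ?thesis by simp
qed

lemma plain_tail:
  assumes "2 \<le> i" "i \<in> I" "2 \<in> I" "3 \<in> I" shows "P (transpose i (Suc i)) \<in> span I"
proof (cases "i = 2")
  case True
  then show ?thesis using plain_23[OF assms(3,4)] by (simp add: numeral_3_eq_3 numeral_2_eq_2)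
next
  case False
  then show ?thesis using plain_adjacent[OF assms(2)] assms(1) by simp
qed

text \<open>Once \<open>\<rho> 3\<close> separates the two factors of \<open>\<rho> 2\<close>, the
  span contains the full product of the symmetric groups on \<open>{0, 1}\<close> and
  \<open>{2..j}\<close>, the stabilizer of the first two columns.\<close>

lemma plain_mem_2:
  assumes "4 \<le> j" "bij \<sigma>" "\<And>x. j < x \<Longrightarrow> \<sigma> x = x" "\<And>x. \<sigma> x < 2 \<longleftrightarrow> x < 2"
  shows "P \<sigma> \<in> span {2..<j}"
proof -
  have main: "P \<tau> \<in> span {2..<j}" if "bij \<tau>" "\<tau> 0 = 0" "\<tau> 1 = 1" "\<And>x. j < x \<Longrightarrow> \<tau> x = x" for \<tau>
  proof (rule plain_mem_of_permutes[of \<tau> 2 j])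
    show "\<tau> permutes {2..j}"
    proof (rule bij_imp_permutes_ext[OF that(1)])
      fix x assume "x \<notin> {2..j}"
      then have "x = 0 \<or> x = 1 \<or> j < x" by auto
      then show "\<tau> x = x" using that by blast
    qed
  qed (use assms(1) in \<open>auto intro: plain_tail\<close>)
  have inj: "\<sigma> 0 \<noteq> \<sigma> 1" using assms(2) by (simp add: bij_is_inj inj_eq)
  have lt: "\<sigma> 0 < 2" "\<sigma> 1 < 2" using assms(4) by simp_all
  show ?thesis
  proof (cases "\<sigma> 0 = 0")
    case True
    then have "\<sigma> 1 = 1" using inj lt by auto
    then show ?thesis by (rule main[OF assms(2) True _ assms(3)])
  next
    case False
    then have v: "\<sigma> 0 = 1" "\<sigma> 1 = 0" using inj lt by auto
    let ?t = "transpose 0 (1::nat)"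
    have "P (?t \<circ> \<sigma>) \<in> span {2..<j}"
      by (rule main) (use assms v in \<open>auto intro: bij_comp\<close>)
    then have "P ?t \<circ> P (?t \<circ> \<sigma>) \<in> span {2..<j}"
      using assms(1) by (intro gen_comp plain_01) auto
    moreover have "?t \<circ> (?t \<circ> \<sigma>) = \<sigma>" by (simp add: fun_eq_iff)
    ultimately show ?thesis by (simp only: P_comp)
  qed
qed

lemma plain_mem_1:
  assumes "4 \<le> j" "\<sigma> permutes {0..j}"
  shows "P \<sigma> \<in> span {1..<j}"
proof (rule plain_mem_of_permutes[OF assms(2)])
  fix i assume i: "i < j"
  consider "i = 0" | "i = 1" | "2 \<le> i" by linarith
  then show "P (transpose i (Suc i)) \<in> span {1..<j}"
  proof cases
    case 1
    then show ?thesis using plain_01[of "{1..<j}"] assms(1) by simp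
  qed (use i assms(1) in \<open>auto intro: plain_adjacent plain_tail\<close>)
qed

lemma plain_mem_12:
  assumes "\<sigma> permutes {1..2}" shows "P \<sigma> \<in> span {1..<2}"
  by (rule plain_mem_of_permutes[OF assms]) (auto intro: plain_adjacent)

lemma dihedral_permutes:
  assumes "bij \<sigma>" "\<And>x. 3 < x \<Longrightarrow> \<sigma> x = x" "dihedral \<sigma>" "\<sigma> 0 = 0"
  shows "\<sigma> permutes {1..2}"
proof (rule bij_imp_permutes_ext[OF assms(1)])
  fix x :: nat assume "x \<notin> {1..2}"
  then consider "x = 0" | "x = 3" | "3 < x" by fastforce
  then show "\<sigma> x = x"
  proof cases
    case 2
    then show ?thesis using assms(3)[unfolded dihedral_def, rule_format, of 0] assms(4) by simp
  qed (use assms in auto)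
qed

text \<open>A symmetry of the square fixing vertex 0 also fixes the opposite vertex 3, so it is the
  identity or \<open>s 1\<close>. In general the image of 0 is brought back along 3, 2, 1, 0 by
  \<open>s 2\<close>, \<open>s 1\<close>, \<open>s 2\<close>.\<close>

lemma plain_mem_dihedral:
  assumes "bij \<sigma>" "\<And>x. 3 < x \<Longrightarrow> \<sigma> x = x" "dihedral \<sigma>"
  shows "P \<sigma> \<in> span {1..<3}"
proof -
  define Q where "Q \<sigma> \<longleftrightarrow> bij \<sigma> \<and> (\<forall>x>3. \<sigma> x = x) \<and> dihedral \<sigma>" for \<sigma>
  have step: "Q (s t \<circ> \<sigma>)" if "Q \<sigma>" "t = 1 \<or> t = 2" for t \<sigma>
  proof -
    have "s t x = x" if "3 < x" for x using s_above[of t 3 x] that \<open>t = 1 \<or> t = 2\<close> by auto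
    then show ?thesis
      using that bij_comp[of \<sigma> "s t"] bij_s[of t] dihedral_step[of t \<sigma>] unfolding Q_def by simp
  qed
  have undo: "P \<sigma> \<in> span {1..<3}" if "P (s t \<circ> \<sigma>) \<in> span {1..<3}" "t = 1 \<or> t = 2" for t \<sigma>
  proof -
    have "\<rho> t \<in> span {1..<3}" using that(2) by (intro gen_base) auto
    from gen_comp[OF this that(1)] have "P (s t) \<circ> P (s t \<circ> \<sigma>) \<in> span {1..<3}"
      using that(2) \<rho>_plain[of t] by auto
    moreover have "s t \<circ> (s t \<circ> \<sigma>) = \<sigma>" by (simp add: fun_eq_iff s_s)
    ultimately show ?thesis by (simp only: P_comp)
  qed
  have 0: "P \<sigma> \<in> span {1..<3}" if "Q \<sigma>" "\<sigma> 0 = 0" for \<sigma>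
    using plain_mem_12[OF dihedral_permutes] that span_mono[of "{1..<2}" "{1..<3}"]
    unfolding Q_def by auto
  have 1: "P \<sigma> \<in> span {1..<3}" if "Q \<sigma>" "\<sigma> 0 = 1" for \<sigma>
    by (rule undo[of 2], rule 0, rule step) (use that in \<open>simp_all add: s_def\<close>)
  have 2: "P \<sigma> \<in> span {1..<3}" if "Q \<sigma>" "\<sigma> 0 = 2" for \<sigma>
    by (rule undo[of 1], rule 1, rule step) (use that in \<open>simp_all add: s_def transpose_def\<close>)
  have 3: "P \<sigma> \<in> span {1..<3}" if "Q \<sigma>" "\<sigma> 0 = 3" for \<sigma>
    by (rule undo[of 2], rule 2, rule step) (use that in \<open>simp_all add: s_def\<close>)
  have Q: "Q \<sigma>" using assms by (simp add: Q_def)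
  have "\<sigma> 0 \<le> 3" using assms(3) by (simp add: dihedral_def)
  then show ?thesis by (cases rule: le_3_cases) (use 0 1 2 3 Q in auto)
qed

lemma permutes_12_cases:
  assumes "\<sigma> permutes {1..2::nat}" "\<sigma> 1 = 1 \<or> \<sigma> 2 = 2" shows "\<sigma> = id"
proof
  fix x :: nat
  have "\<sigma> 1 \<in> {1..2}" "\<sigma> 2 \<in> {1..2}" using permutes_in_image[OF assms(1)] by auto
  moreover have "\<sigma> 1 \<noteq> \<sigma> 2" using permutes_inj[OF assms(1)] by (simp add: inj_eq)
  ultimately have "\<sigma> 1 = 1" "\<sigma> 2 = 2" using assms(2) by auto
  moreover have "x = 1 \<or> x = 2 \<or> x \<notin> {1..2}" by auto
  ultimately show "\<sigma> x = id x" using permutes_not_in[OF assms(1), of x] by auto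
qed

sublocale interval_intersection \<rho> r for r
proof
  fix i j :: nat assume ij: "i < j"
  show "span {i..<j} \<inter> span {Suc i..<Suc j} \<subseteq> span {Suc i..<j}"
  proof
    fix g assume "g \<in> span {i..<j} \<inter> span {Suc i..<Suc j}"
    then have g: "g \<in> span {i..<j}" "g \<in> span {Suc i..<Suc j}" by auto
    obtain \<sigma> f where gW: "g = W \<sigma> f" using g by (elim span_form)
    have f: "f = (\<lambda>_. False)" using g(2) span_plain[of \<sigma> f "{Suc i..<Suc j}"] gW by simp
    have gP: "g = P \<sigma>" using gW f by simp
    note g = g[unfolded gP]
    have bij: "bij \<sigma>" using span_bij_left[OF g(1)] .
    have above: "\<sigma> x = x" if "j < x" for x using span_above(1)[OF g(1) _ that] ij by simp
    have idc: "P \<sigma> \<in> span I" if "\<sigma> = id" for I using that W_id gen_id by metis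
    \<comment> \<open>The second interval omits \<open>\<rho> 0\<close>, so only columns matter. In
      the listed order, the column group of the common interval is a symmetric group on consecutive
      columns, trivial, generated by \<open>s 2\<close>, the stabilizer of \<open>{0, 1}\<close>,
      trivial, generated by \<open>s 1\<close>, dihedral, and the full symmetric group.\<close>
    consider "2 \<le> i" | "i = 1" "j = 2" | "i = 1" "j = 3" | "i = 1" "4 \<le> j"
      | "i = 0" "j = 1" | "i = 0" "j = 2" | "i = 0" "j = 3" | "i = 0" "4 \<le> j"
      using ij by linarith
    then have "P \<sigma> \<in> span {Suc i..<j}"
    proof cases
      case 1
      then have p: "\<sigma> permutes {Suc i..Suc j}" using span_permutes[OF g(2)] by simp
      have "\<sigma> permutes {Suc i..j}"
        by (rule permutes_superset[OF p]) (use above in auto)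
      then show ?thesis
        by (rule plain_mem_of_permutes) (use 1 in \<open>auto intro: plain_adjacent\<close>)
    next
      case 2
      then have p: "\<sigma> permutes {1..2}" using span_permutes[OF g(1)] by simp
      have "\<sigma> 1 < 2" using span_less_2[of \<sigma> "\<lambda>_. False" 3 1] g(2) 2
        by (simp add: numeral_2_eq_2 numeral_3_eq_3)
      moreover have "\<sigma> 1 \<in> {1..2}" using permutes_in_image[OF p] by simp
      ultimately have "\<sigma> 1 = 1" by auto
      then have "\<sigma> = id" by (intro permutes_12_cases[OF p] disjI1)
      then show ?thesis by (rule idc)
    next
      case 3
      then have d: "dihedral \<sigma>" using span_dihedral[OF g(1)[unfolded 3]] by simp
      have lt: "\<sigma> x < 2 \<longleftrightarrow> x < 2" for x
        using span_less_2[of \<sigma> "\<lambda>_. False" "Suc j" x] g(2) 3 by (simp add: numeral_2_eq_2)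
      have v: "\<sigma> 3 = 3 - \<sigma> 0" "\<sigma> 2 = 3 - \<sigma> 1"
        using d[unfolded dihedral_def, rule_format, of 0] d[unfolded dihedral_def, rule_format, of 1]
        by simp_all
      have "\<sigma> 0 < 2" "\<sigma> 1 < 2" "\<sigma> 0 \<noteq> \<sigma> 1"
        using lt bij by (simp_all add: bij_is_inj inj_eq)
      then consider "\<sigma> 0 = 0" "\<sigma> 1 = 1" | "\<sigma> 0 = 1" "\<sigma> 1 = 0" by linarith
      then show ?thesis
      proof cases
        case 1
        have "\<sigma> = id"
        proof
          fix x show "\<sigma> x = id x"
          proof (cases "x \<le> 3")
            case True
            then show ?thesis by (cases rule: le_3_cases) (use 1 v in simp_all)
          next
            case False
            then show ?thesis using above[of x] 3 by simp
          qed
        qed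
        then show ?thesis by (rule idc)
      next
        case 2
        have "\<sigma> = s 2"
        proof
          fix x show "\<sigma> x = s 2 x"
          proof (cases "x \<le> 3")
            case True
            then show ?thesis by (cases rule: le_3_cases) (use 2 v in \<open>simp_all add: s_def\<close>)
          next
            case False
            then show ?thesis using above[of x] 3 s_above[of 2 3 x] by simp
          qed
        qed
        then have "P \<sigma> = \<rho> 2" using \<rho>_plain[of 2] by simp
        moreover have "\<rho> 2 \<in> span {Suc i..<j}" by (intro gen_base) (use 3 in auto)
        ultimately show ?thesis by simp
      qed
    next
      case 4
      have "\<sigma> x < 2 \<longleftrightarrow> x < 2" for x
        using span_less_2[of \<sigma> "\<lambda>_. False" "Suc j" x] g(2) 4 by (simp add: numeral_2_eq_2)
      then show ?thesis
        using plain_mem_2[OF 4(2) bij above] 4(1) by (simp add: numeral_2_eq_2)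
    next
      case 5
      then have p: "\<sigma> permutes {1..2}"
        using span_permutes[of \<sigma> "\<lambda>_. False" 1 2] g(2) by (simp add: numeral_2_eq_2)
      have "\<sigma> = id" by (rule permutes_12_cases[OF p]) (use above[of 2] 5 in simp)
      then show ?thesis by (rule idc)
    next
      case 6
      have d: "dihedral \<sigma>"
        using span_dihedral[of \<sigma> "\<lambda>_. False"] g(2) 6 by (simp add: numeral_3_eq_3 numeral_2_eq_2)
      have "\<sigma> 3 = 3" using above[of 3] 6 by simp
      then have "\<sigma> 0 = 0"
        using d[unfolded dihedral_def, rule_format, of 3] by simp
      then have "\<sigma> permutes {1..2}" using dihedral_permutes[OF bij _ d] above 6 by simp
      then show ?thesis using plain_mem_12 6 by simp
    next
      case 7
      \<comment> \<open>With no flips, the invariant of \<open>span_cube\<close> says for both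
        values of \<open>twisted\<close> that pairs of columns with sum 3 are preserved.\<close>
      have "dihedral \<sigma>"
        unfolding dihedral_def
      proof (intro allI impI)
        fix x :: nat assume x: "x \<le> 3"
        have "x \<noteq> 3 - x" by presburger
        then have "\<sigma> x \<le> 3" "\<sigma> x + \<sigma> (3 - x) = 3"
          using span_cube[of \<sigma> "\<lambda>_. False" x "3 - x"] g(1) 7 x by auto
        then show "\<sigma> x \<le> 3 \<and> \<sigma> (3 - x) = 3 - \<sigma> x" by simp
      qed
      then show ?thesis using plain_mem_dihedral[OF bij] above 7 by simp
    next
      case 8
      have "\<sigma> permutes {0..j}" by (rule bij_imp_permutes_ext[OF bij]) (use above in auto)
      then show ?thesis using plain_mem_1[OF 8(2)] 8(1) by simp
    qed
    then show "g \<in> span {Suc i..<j}" using gP by simp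
  qed
qed

lemma \<rho>_pt: "\<rho> i (pt x b) = pt (s i x) (b \<noteq> (i = 0 \<and> x < 2))"
  by (simp add: \<rho>_def u_def)

lemma s_Suc: "0 < x \<Longrightarrow> s x (Suc x) = x" "0 < x \<Longrightarrow> s x x = Suc x"
  by (auto simp: s_def transpose_def)

theorem half_system_corner:
  assumes m: "3 \<le> m"
  shows "half_system \<rho> m {1..2 * m + 2} (pt m True)"
proof
  show "finite {1..2 * m + 2}" "2 \<le> m" using m by auto
  fix i
  have bij: "bij (\<rho> i)" using invol[of i] by (rule o_bij[OF _ invol])
  { assume i: "i < m"
    show "\<rho> i permutes {1..2 * m + 2}"
      using bij unfolding \<rho>_def by (rule W_permutes) (use s_above[OF i] m in \<open>auto simp: u_def\<close>)
    have pW: "permutation (P (transpose a b))" for a b :: nat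
      by (rule permutation_W[of _ _ "max a b"], rule bij_W_involution) auto
    have pf: "permutation (W id (\<lambda>x. x < 2))"
      by (rule permutation_W[of _ _ 2], rule bij_W_involution) auto
    consider "i = 0" | "i = 2" | "i \<noteq> 0" "i \<noteq> 2" by blast
    then show "evenperm (\<rho> i)"
    proof cases
      case 1
      show ?thesis
      proof (cases twisted)
        case True
        have eq: "\<rho> i = W id (\<lambda>x. x < 2) \<circ> P (transpose 0 1)"
          unfolding \<rho>_def W_comp s_def u_def using True 1 by (intro W_eqI) (auto simp: transpose_def)
        show ?thesis
          unfolding eq evenperm_comp[OF pf pW] using even_W_transpose even_W_flip_below[of 2] by simp
      next
        case False
        have "\<rho> i = W id (\<lambda>x. x < 2)"
          unfolding \<rho>_def s_def u_def using False 1 by (intro W_eqI) auto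
        then show ?thesis using even_W_flip_below[of 2] by simp
      qed
    next
      case 2
      have eq: "\<rho> i = P (transpose 0 1) \<circ> P (transpose 2 3)"
        unfolding P_comp \<rho>_def by (rule W_eqI) (auto simp: 2 s_def u_def)
      show ?thesis unfolding eq evenperm_comp[OF pW pW] using even_W_transpose by simp
    next
      case 3
      then have "\<rho> i = P (transpose i (Suc i))" by (simp add: \<rho>_plain s_def)
      then show ?thesis using even_W_transpose by simp
    qed
    show "\<rho> i \<noteq> id"
    proof
      assume "\<rho> i = id"
      then show False using \<rho>_pt[of i i True] s_Suc(2)[of i] by (cases "i = 0") simp_all
    qed }
  show "\<rho> i (pt m True) = pt m True" if "Suc i < m"
    using that m s_above[of i "m - 1" m] by (simp add: \<rho>_pt)
  show "\<rho> (m - 1) (pt m True) \<noteq> pt m True"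
    using m s_Suc(1)[of "m - 1"] by (simp add: \<rho>_pt)
  let ?R = "(\<lambda>g. g (pt m True)) ` span {..<m}"
  have step: "\<rho> i y \<in> ?R" if y: "y \<in> ?R" and i: "i < m" for i y
  proof -
    obtain g where g: "g \<in> span {..<m}" "y = g (pt m True)" using y by blast
    have "\<rho> i \<circ> g \<in> span {..<m}" by (rule gen_step[OF _ g(1)]) (use i in simp)
    then show ?thesis by (rule image_eqI[rotated]) (simp add: g(2))
  qed
  have up: "pt x True \<in> ?R" if "1 \<le> x" "x \<le> m" for x
    using that(2,1)
  proof (induction rule: inc_induct)
    case base
    show ?case by (rule image_eqI[OF _ gen_id]) simp
  next
    case (step x)
    then show ?case
      using \<open>\<And>i y. y \<in> ?R \<Longrightarrow> i < m \<Longrightarrow> \<rho> i y \<in> ?R\<close>[of "pt (Suc x) True" x] s_Suc(1)[of x]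
      by (simp add: \<rho>_pt)
  qed
  \<comment> \<open>Column 0 is reached from column 1 by \<open>\<rho> 2\<close>, which keeps the
    row.\<close>
  have up0: "pt 0 True \<in> ?R"
    using step[OF up[of 1], of 2] m by (simp add: \<rho>_pt s_def)
  have down01: "pt 0 False \<in> ?R" "pt 1 False \<in> ?R"
  proof -
    have "pt (s 0 0) False \<in> ?R" "pt (s 0 1) False \<in> ?R"
      using step[OF up0, of 0] step[OF up[of 1], of 0] m by (simp_all add: \<rho>_pt)
    moreover have "s 0 0 = (if twisted then 1 else 0)" "s 0 1 = (if twisted then 0 else 1)"
      by (simp_all add: s_def)
    ultimately show "pt 0 False \<in> ?R" "pt 1 False \<in> ?R" by (metis, metis)
  qed
  have down: "pt x False \<in> ?R" if "1 \<le> x" "x \<le> m" for x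
    using that
  proof (induction x rule: dec_induct)
    case base
    show ?case by (rule down01)
  next
    case (step x)
    then show ?case
      using \<open>\<And>i y. y \<in> ?R \<Longrightarrow> i < m \<Longrightarrow> \<rho> i y \<in> ?R\<close>[of "pt x False" x] s_Suc(2)[of x]
      by (simp add: \<rho>_pt)
  qed
  show "{1..2 * m + 2} \<subseteq> ?R"
  proof
    fix y assume y: "y \<in> {1..2 * m + 2}"
    show "y \<in> ?R"
    proof (cases y rule: pt_cases)
      case (2 x b)
      then have "x \<le> m" using y pt_mem_iff by metis
      then show ?thesis using up up0 down down01(1) 2 by (cases b; cases "x = 0") simp_all
    qed (use y in auto)
  qed
  fix g
  assume i: "Suc i < m" and g: "g \<in> span {i..<m}"
    and fixd: "\<And>x. x \<notin> (\<lambda>h. h (pt m True)) ` span {Suc i..<m} \<Longrightarrow> g x = x"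
  obtain \<sigma> f where gW: "g = W \<sigma> f" using g by (elim span_form)
  \<comment> \<open>Without \<open>\<rho> 0\<close> the orbit of \<open>c\<close> stays in the upper
    row, so \<open>g\<close> fixes the lower row pointwise and is the identity.\<close>
  have "g (pt x False) = pt x False" for x
  proof (rule fixd, rule notI)
    assume "pt x False \<in> (\<lambda>h. h (pt m True)) ` span {Suc i..<m}"
    then obtain h where h: "h \<in> span {Suc i..<m}" "pt x False = h (pt m True)" by blast
    obtain \<tau> f' where hW: "h = W \<tau> f'" using h(1) by (elim span_form)
    have "f' = (\<lambda>_. False)" using h(1) span_plain[of \<tau> f' "{Suc i..<m}"] hW by simp
    then show False using h(2) hW by simp
  qed
  then have "\<sigma> = id \<and> f = (\<lambda>_. False)" unfolding gW by (auto simp: fun_eq_iff)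
  then show "g \<in> span {Suc i..<m}" unfolding gW using gen_id W_id by metis
qed

end

section \<open>The self-dual string C-groups\<close>

lemma doubled_system_delta:
  assumes "half_system \<rho> m {1..2 * m + 2} (pt m True)"
  shows "doubled_system \<rho> m {1..2 * m + 2} (pt m True) (delta m)"
proof -
  interpret half_system \<rho> m "{1..2 * m + 2}" "pt m True" by (rule assms)
  show ?thesis
  proof
    show "delta m \<circ> delta m = id" by (rule delta_invol)
    show "permutation (delta m)"
      using delta_permutes permutes_imp_permutation by blast
    show "delta m (pt m True) = pt m True" by (simp add: delta_def pt_def)
    show "{1..2 * m + 2} \<inter> delta m ` {1..2 * m + 2} = {pt m True}"
      unfolding delta_image by (auto simp: pt_def)
  qed
qed

lemma involution_inverse: "s \<circ> s = id \<Longrightarrow> inv' s = s"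
  by (rule inv_unique_comp)

section \<open>Transfer to the alternating group\<close>

lemma generate_alt_group:
  assumes H: "H \<subseteq> carrier (alt_group n)" and inv: "\<And>s. s \<in> H \<Longrightarrow> s \<circ> s = id"
  shows "generate (alt_group n) H = gen H"
proof
  show "generate (alt_group n) H \<subseteq> gen H"
  proof
    fix g assume "g \<in> generate (alt_group n) H"
    then show "g \<in> gen H"
    proof induction
      case one
      show ?case unfolding alt_group_one by (rule gen_id)
    next
      case (incl h)
      then show ?case by (rule gen_base)
    next
      case (inv h)
      have "inv\<^bsub>alt_group n\<^esub> h = h"
        using alt_group_inv_equality[of h n] involution_inverse[OF assms(2)] inv H by auto
      then show ?case using gen_base[OF inv] by simp
    next
      case (eng g h)
      then show ?case unfolding alt_group_mult by (intro gen_comp)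
    qed
  qed
  show "gen H \<subseteq> generate (alt_group n) H"
  proof
    fix g assume "g \<in> gen H"
    then show "g \<in> generate (alt_group n) H"
    proof induction
      case gen_id
      show ?case using generate.one[of "alt_group n" H] unfolding alt_group_one .
    next
      case (gen_step s g)
      show ?case
        using generate.eng[OF generate.incl[OF gen_step(1)] gen_step(3)] unfolding alt_group_mult .
    qed
  qed
qed

lemma alt_group_pow: "x [^]\<^bsub>alt_group n\<^esub> (k::nat) = x ^^ k"
proof (induction k)
  case 0
  show ?case by (simp add: alt_group_one nat_pow_0)
next
  case (Suc k)
  then show ?case by (simp add: alt_group_mult funpow_Suc_right del: funpow.simps)
qed

lemma alt_group_square: "x [^]\<^bsub>alt_group n\<^esub> (2::nat) = x \<circ> x"
  by (simp only: alt_group_pow numeral_2_eq_2 funpow.simps comp_id)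

definition gens :: "(nat \<Rightarrow> nat \<Rightarrow> nat) \<Rightarrow> nat \<Rightarrow> (nat \<Rightarrow> nat) list"
  where "gens \<rho> m = map (doubled_system.\<tau> \<rho> m (delta m)) [0..<2 * m]"

lemma length_gens [simp]: "length (gens \<rho> m) = 2 * m"
  by (simp add: gens_def)

text \<open>As a product of \<open>2 * m + 1\<close> transpositions \<open>delta m\<close> is odd
  and lies outside the alternating group, but conjugation preserves parity.\<close>

lemma delta_conj_iso: "(\<lambda>p. delta m \<circ> p \<circ> delta m) \<in> iso (alt_group (4 * m + 3)) (alt_group (4 * m + 3))"
proof (rule isoI)
  let ?G = "alt_group (4 * m + 3)" and ?d = "delta m"
  have perm: "permutation p" if "p permutes {1..4 * m + 3}" for p
    using that permutes_imp_permutation by blast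
  have closed: "?d \<circ> p \<circ> ?d \<in> carrier ?G" if "p \<in> carrier ?G" for p
  proof -
    have p: "p permutes {1..4 * m + 3}" "evenperm p" using that by (auto simp: alt_group_carrier)
    note d = delta_permutes[of m]
    have "evenperm (?d \<circ> p \<circ> ?d)"
      unfolding evenperm_comp[OF permutation_compose[OF perm[OF d] perm[OF p(1)]] perm[OF d]]
        evenperm_comp[OF perm[OF d] perm[OF p(1)]] using p(2) by simp
    then show ?thesis
      unfolding alt_group_carrier using permutes_compose[OF d permutes_compose[OF p(1) d]]
      by (simp add: comp_assoc)
  qed
  have dd: "?d \<circ> (?d \<circ> f) = f" for f :: "nat \<Rightarrow> nat"
    unfolding o_assoc delta_invol by simp
  have undo: "?d \<circ> (?d \<circ> p \<circ> ?d) \<circ> ?d = p" for p :: "nat \<Rightarrow> nat"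
    by (simp add: comp_assoc dd delta_invol)
  show "(\<lambda>p. ?d \<circ> p \<circ> ?d) \<in> hom ?G ?G"
    using closed by (auto intro!: homI simp: alt_group_mult comp_assoc dd)
  show "bij_betw (\<lambda>p. ?d \<circ> p \<circ> ?d) (carrier ?G) (carrier ?G)"
    by (rule bij_betw_byWitness[where f' = "\<lambda>p. ?d \<circ> p \<circ> ?d"]) (use closed undo in auto)
qed

theorem doubled_string_C_group:
  assumes "half_system \<rho> m {1..2 * m + 2} (pt m True)"
  shows "string_C_group (alt_group (4 * m + 3)) (gens \<rho> m)"
    and "self_dual (alt_group (4 * m + 3)) (gens \<rho> m)"
proof -
  interpret D: doubled_system \<rho> m "{1..2 * m + 2}" "pt m True" "delta m"
    by (rule doubled_system_delta[OF assms])
  let ?G = "alt_group (4 * m + 3)"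
  have nth: "gens \<rho> m ! i = D.\<tau> i" if "i < 2 * m" for i
    using that by (simp add: gens_def)
  have set: "set (gens \<rho> m) = D.\<tau> ` {..<2 * m}"
    by (auto simp: gens_def)
  have "{1..2 * m + 2} \<union> delta m ` {1..2 * m + 2} = {1..4 * m + 3}"
    unfolding delta_image by auto
  then have all: "gen (D.\<tau> ` {..<2 * m}) = carrier ?G"
    using D.T_span_all by (auto simp: alt_group_carrier)
  have closed: "D.\<tau> ` {..<2 * m} \<subseteq> carrier ?G"
    unfolding all[symmetric] by (intro subsetI gen_base)
  have span: "generate ?G ((\<lambda>i. gens \<rho> m ! i) ` I) = gen (D.\<tau> ` I)" if "I \<subseteq> {..<2 * m}" for I
  proof -
    have "(\<lambda>i. gens \<rho> m ! i) ` I = D.\<tau> ` I"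
      using that by (intro image_cong) (auto simp: nth)
    moreover have "generate ?G (D.\<tau> ` I) = gen (D.\<tau> ` I)"
      using closed that D.\<tau>_invol by (intro generate_alt_group) auto
    ultimately show ?thesis by simp
  qed
  show "string_C_group ?G (gens \<rho> m)"
  proof (intro string_C_group.intro sggi.intro sggi_axioms.intro string_C_group_axioms.intro)
    show "group ?G" by (rule alt_group_is_group)
    show "set (gens \<rho> m) \<subseteq> carrier ?G" using set closed by simp
    show "generate ?G (set (gens \<rho> m)) = carrier ?G"
      unfolding set using generate_alt_group[OF closed] D.\<tau>_invol all by auto
    fix i assume i: "i < length (gens \<rho> m)"
    then show "gens \<rho> m ! i \<noteq> \<one>\<^bsub>?G\<^esub>"
      using D.\<tau>_nontrivial by (simp add: nth alt_group_one)
    show "(gens \<rho> m ! i) [^]\<^bsub>?G\<^esub> (2::nat) = \<one>\<^bsub>?G\<^esub>"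
      using i D.\<tau>_invol[of i] by (simp add: nth alt_group_square alt_group_one)
  next
    fix i j assume i: "i < length (gens \<rho> m)" and j: "j < length (gens \<rho> m)"
      and ij: "\<bar>int i - int j\<bar> \<ge> 2"
    have "D.\<tau> i \<circ> D.\<tau> j = D.\<tau> j \<circ> D.\<tau> i"
      using ij D.\<tau>_comm[of i j] D.\<tau>_comm[of j i] by (cases "i < j") auto
    then have "D.\<tau> i \<circ> D.\<tau> j \<circ> (D.\<tau> i \<circ> D.\<tau> j) = id"
      using D.\<tau>_invol by (metis comp_assoc comp_id)
    then show "(gens \<rho> m ! i \<otimes>\<^bsub>?G\<^esub> gens \<rho> m ! j) [^]\<^bsub>?G\<^esub> (2::nat) = \<one>\<^bsub>?G\<^esub>"
      using i j by (simp add: nth alt_group_square alt_group_one alt_group_mult)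
  next
    fix I J assume I: "I \<subseteq> {..<length (gens \<rho> m)}" and J: "J \<subseteq> {..<length (gens \<rho> m)}"
    then have "I \<inter> J \<subseteq> {..<2 * m}" by auto
    then show "generate ?G ((\<lambda>i. gens \<rho> m ! i) ` I) \<inter> generate ?G ((\<lambda>j. gens \<rho> m ! j) ` J) =
        generate ?G ((\<lambda>k. gens \<rho> m ! k) ` (I \<inter> J))"
      using D.T.span_inter[of I J] I J by (simp add: span)
  qed
  show "self_dual ?G (gens \<rho> m)"
    unfolding self_dual_def
  proof (intro bexI[OF _ delta_conj_iso] allI impI)
    fix i assume "i < length (gens \<rho> m)"
    then show "delta m \<circ> gens \<rho> m ! i \<circ> delta m = gens \<rho> m ! (length (gens \<rho> m) - 1 - i)"
      using D.\<tau>_dual[of i] by (simp add: nth)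
  qed
qed

text \<open>The isomorphism invariant used for separation: which powers of adjacent products vanish.
  Single powers are enough, so exact orders need not be computed.\<close>

lemma isomorphic_sggi_power_eq_id:
  assumes iso: "isomorphic_sggi (alt_group n, \<rho>s) (alt_group n, \<sigma>s)"
    and \<rho>s: "set \<rho>s \<subseteq> carrier (alt_group n)" and i: "Suc i < length \<rho>s"
  shows "(\<rho>s ! i \<circ> \<rho>s ! Suc i) ^^ k = id \<longleftrightarrow> (\<sigma>s ! i \<circ> \<sigma>s ! Suc i) ^^ k = id"
proof -
  let ?G = "alt_group n"
  interpret G: group ?G by (rule alt_group_is_group)
  from iso obtain \<phi> where \<phi>: "\<phi> \<in> iso ?G ?G" "\<And>i. i < length \<rho>s \<Longrightarrow> \<phi> (\<rho>s ! i) = \<sigma>s ! i"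
    by (auto simp: isomorphic_sggi_def)
  interpret \<phi>: group_hom ?G ?G \<phi>
    using \<phi>(1) by unfold_locales (simp add: iso_def)
  let ?x = "\<rho>s ! i \<otimes>\<^bsub>?G\<^esub> \<rho>s ! Suc i" and ?y = "\<sigma>s ! i \<otimes>\<^bsub>?G\<^esub> \<sigma>s ! Suc i"
  have mem: "\<rho>s ! i \<in> carrier ?G" "\<rho>s ! Suc i \<in> carrier ?G"
    using \<rho>s i by (auto simp: subset_iff)
  then have x: "?x \<in> carrier ?G" by simp
  have "\<phi> (?x [^]\<^bsub>?G\<^esub> k) = ?y [^]\<^bsub>?G\<^esub> k"
    using mem x \<phi>(2) i by (simp add: \<phi>.hom_nat_pow)
  moreover have "inj_on \<phi> (carrier ?G)" using \<phi>(1) by (simp add: iso_def bij_betw_def)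
  then have "\<phi> z = \<one>\<^bsub>?G\<^esub> \<longleftrightarrow> z = \<one>\<^bsub>?G\<^esub>" if "z \<in> carrier ?G" for z
    using inj_on_eq_iff[of \<phi> "carrier ?G" z "\<one>\<^bsub>?G\<^esub>"] that by simp
  from this[OF G.nat_pow_closed[OF x, of k]]
  have "\<phi> (?x [^]\<^bsub>?G\<^esub> k) = \<one>\<^bsub>?G\<^esub> \<longleftrightarrow> ?x [^]\<^bsub>?G\<^esub> k = \<one>\<^bsub>?G\<^esub>" .
  ultimately have "?x [^]\<^bsub>?G\<^esub> k = \<one>\<^bsub>?G\<^esub> \<longleftrightarrow> ?y [^]\<^bsub>?G\<^esub> k = \<one>\<^bsub>?G\<^esub>"
    by simp
  then show ?thesis by (simp add: alt_group_pow alt_group_mult alt_group_one)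
qed

section \<open>Orders of adjacent products\<close>

context rung_family
begin

lemma power_3_eq_id:
  assumes "Suc i < k" shows "(\<rho> i \<circ> \<rho> (Suc i)) ^^ 3 = id"
proof -
  have "\<rho> i = W (s i) (\<lambda>_. False)" "\<rho> (Suc i) = W (s (Suc i)) (\<lambda>_. False)"
    using assms unfolding \<rho>_def u_def by (auto intro!: W_eqI)
  then have "(\<rho> i \<circ> \<rho> (Suc i)) ^^ 3 = W id (\<lambda>_. False)"
    unfolding numeral_3_eq_3 funpow.simps comp_id by (auto simp: W_comp transpose_def intro!: W_eqI)
  then show ?thesis by (simp only: W_id)
qed

lemma power_3_neq_id:
  assumes "k = Suc l" shows "(\<rho> l \<circ> \<rho> k) ^^ 3 \<noteq> id"
proof
  assume "(\<rho> l \<circ> \<rho> k) ^^ 3 = id"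
  then have "((\<rho> l \<circ> \<rho> k) ^^ 3) (pt k True) = pt k True" by simp
  moreover have "l < k" using assms by simp
  then have "\<rho> k (pt k b) = pt (Suc k) b" "\<rho> k (pt (Suc k) b) = pt k b"
    "\<rho> k (pt l b) = pt l (\<not> b)" "\<rho> l (pt l b) = pt k b" "\<rho> l (pt k b) = pt l b"
    "\<rho> l (pt (Suc k) b) = pt (Suc k) b" for b
    by (simp_all add: \<rho>_pt assms[symmetric])
  ultimately show False
    using \<open>l < k\<close> by (simp add: numeral_3_eq_3)
qed

text \<open>For every admissible \<open>k\<close> the product cycles the columns 1, 2, 3, and 3 does
  not divide 4.\<close>

lemma power_4_neq_id: "(\<rho> 1 \<circ> \<rho> 2) ^^ 4 \<noteq> id"
proof
  assume "(\<rho> 1 \<circ> \<rho> 2) ^^ 4 = id"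
  then have "((\<rho> 1 \<circ> \<rho> 2) ^^ 4) (pt 1 True) = pt 1 True" by simp
  then show False
    by (simp add: eval_nat_numeral \<rho>_pt transpose_def)
qed

end

context corner_family
begin

text \<open>Column 0 stays in place and is flipped at each of the three steps.\<close>

lemma untwisted_power_3_neq_id:
  assumes "\<not> twisted" shows "(\<rho> 0 \<circ> \<rho> 1) ^^ 3 \<noteq> id"
proof
  assume "(\<rho> 0 \<circ> \<rho> 1) ^^ 3 = id"
  then have "((\<rho> 0 \<circ> \<rho> 1) ^^ 3) (pt 0 True) = pt 0 True" by simp
  moreover have "s 0 0 = 0" "s 1 0 = 0" unfolding s_def using assms by simp_all
  ultimately show False by (simp add: numeral_3_eq_3 \<rho>_pt)
qed

text \<open>Columns 0, 1, 2 are cycled with a flip on two of the three steps, so the flips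
  cancel.\<close>

lemma twisted_power_3_eq_id:
  assumes twisted shows "(\<rho> 0 \<circ> \<rho> 1) ^^ 3 = id"
proof -
  have "(\<rho> 0 \<circ> \<rho> 1) ^^ 3 = W id (\<lambda>_. False)"
    unfolding numeral_3_eq_3 funpow.simps comp_id \<rho>_def W_comp s_def u_def
    using assms by (intro W_eqI) (auto simp: transpose_def)
  then show ?thesis by (simp only: W_id)
qed

text \<open>The product of the two reflections is a rotation of the square on the first four
  columns.\<close>

lemma power_4_eq_id: "(\<rho> 1 \<circ> \<rho> 2) ^^ 4 = id"
proof -
  let ?w = "s 1 \<circ> s 2"
  have v: "s 1 0 = 0" "s 1 1 = 2" "s 1 2 = 1" "s 1 3 = 3" "s 2 0 = 1" "s 2 1 = 0" "s 2 2 = 3" "s 2 3 = 2"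
    by (simp_all add: s_def transpose_def)
  have "(?w \<circ> (?w \<circ> (?w \<circ> ?w))) x = x" for x
  proof (cases "x \<le> 3")
    case True
    then show ?thesis by (cases rule: le_3_cases) (simp_all only: comp_apply v)
  next
    case False
    then have "s 1 x = x" "s 2 x = x" by (simp_all add: s_above[of _ 3])
    then show ?thesis by (simp only: comp_apply)
  qed
  then have "?w \<circ> (?w \<circ> (?w \<circ> ?w)) = id" by (intro ext) (simp only: id_apply)
  moreover have w: "\<rho> 1 \<circ> \<rho> 2 = P ?w" by (simp only: \<rho>_plain P_comp zero_less_one zero_less_numeral)
  have four: "(4::nat) = Suc (Suc (Suc (Suc 0)))" by simp
  have "(\<rho> 1 \<circ> \<rho> 2) ^^ 4 = P (?w \<circ> (?w \<circ> (?w \<circ> ?w)))"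
    unfolding w four funpow.simps comp_id P_comp ..
  ultimately show ?thesis by (simp only: W_id)
qed

end

section \<open>Indexing and counting the systems\<close>

definition family :: "nat \<Rightarrow> nat \<Rightarrow> nat \<Rightarrow> nat" where
  "family k = (if k < 2 then corner_family.\<rho> (k = 1) else rung_family.\<rho> k)"

text \<open>Rung indices are even and at least 2, which frees 0 and 1 for the untwisted and the
  twisted corner system. The even numbers below \<open>m\<close> thus include one corner index, and
  1 adds the other.\<close>

definition indices :: "nat \<Rightarrow> nat set"
  where "indices m = insert 1 ((\<lambda>j. 2 * j) ` {..<(m + 1) div 2})"

lemma indices_cases:
  assumes "k \<in> indices m"
  obtains "k = 0" | "k = 1" | "rung_family k" "k < m"
proof (cases "k < 2")
  case False
  then have "even k" "k < m" using assms by (auto simp: indices_def)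
  then show ?thesis using that False by (simp add: rung_family_def)
next
  case True
  then have "k = 0 \<or> k = 1" by auto
  then show ?thesis using that by blast
qed

lemma card_indices: "finite (indices m)" "card (indices m) = (m + 3) div 2"
proof -
  show "finite (indices m)" by (simp add: indices_def)
  have "1 \<notin> (\<lambda>j. 2 * j) ` {..<(m + 1) div 2}"
  proof
    assume "1 \<in> (\<lambda>j. 2 * j) ` {..<(m + 1) div 2}"
    then obtain j :: nat where "1 = 2 * j" by blast
    then show False by presburger
  qed
  moreover have "card ((\<lambda>j. 2 * j) ` {..<(m + 1) div 2}) = (m + 1) div 2"
    by (subst card_image) (auto simp: inj_on_def)
  ultimately show "card (indices m) = (m + 3) div 2" by (simp add: indices_def)
qed

lemma half_system_family:
  assumes "k \<in> indices m" "3 \<le> m"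
  shows "half_system (family k) m {1..2 * m + 2} (pt m True)"
  using assms(1)
proof (cases rule: indices_cases)
  case 3
  then show ?thesis
    using rung_family.half_system_rung[OF 3] by (simp add: family_def rung_family_def)
qed (use assms(2) corner_family.half_system_corner in \<open>simp_all add: family_def\<close>)

text \<open>The cube of the product at position 0 is nontrivial in the untwisted corner system, and
  at position \<open>k - 1\<close> in the rung system of \<open>k\<close>; in systems of larger
  index it vanishes there. The twisted system is separated from the rungs by the fourth power at
  position 1; the cube there would not do, since it is nontrivial also in the rung system of
  2.\<close>

lemma family_distinguished:
  assumes k: "k \<in> indices m" "l \<in> indices m" "k < l" and m: "3 \<le> m"
  shows "\<exists>i p. Suc i < m \<and> ((family k i \<circ> family k (Suc i)) ^^ p = id) \<noteq>
    ((family l i \<circ> family l (Suc i)) ^^ p = id)"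
proof -
  have three: "(family l i \<circ> family l (Suc i)) ^^ 3 = id" if "Suc i < l \<or> i = 0 \<and> l = 1" for i
    using k(2)
  proof (cases rule: indices_cases)
    case 2
    then have i: "i = 0" using that by simp
    show ?thesis
      using corner_family.twisted_power_3_eq_id[of True] by (simp add: family_def 2 i)
  next
    case 3
    then show ?thesis
      using rung_family.power_3_eq_id[OF 3(1)] that by (simp add: family_def rung_family_def)
  qed (use that in simp)
  show ?thesis
    using k(1)
  proof (cases rule: indices_cases)
    case 1
    have "(family k 0 \<circ> family k (Suc 0)) ^^ 3 \<noteq> id"
      using corner_family.untwisted_power_3_neq_id[of False] by (simp add: family_def 1)
    moreover have "Suc 0 < l \<or> l = 1" using k(3) by auto
    ultimately show ?thesis using three[of 0] m by (intro exI[of _ 0] exI[of _ 3]) simp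
  next
    case 2
    have "(family k 1 \<circ> family k (Suc 1)) ^^ 4 = id"
      using corner_family.power_4_eq_id[of True] by (simp add: family_def 2 numeral_2_eq_2)
    moreover have "rung_family l" using k(2,3) 2 by (cases rule: indices_cases) auto
    then have "(family l 1 \<circ> family l (Suc 1)) ^^ 4 \<noteq> id"
      using rung_family.power_4_neq_id[of l] k(3) 2 by (simp add: family_def numeral_2_eq_2)
    ultimately show ?thesis using m by (intro exI[of _ 1] exI[of _ 4]) simp
  next
    case 3
    then obtain i where i: "k = Suc i" by (cases k) (auto simp: rung_family_def)
    have "(family k i \<circ> family k (Suc i)) ^^ 3 \<noteq> id"
      using rung_family.power_3_neq_id[OF 3(1) i] 3(1) i by (simp add: family_def rung_family_def)
    then show ?thesis using three[of i] k(3) i 3(2) by (intro exI[of _ i] exI[of _ 3]) simp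
  qed
qed

lemma gens_not_isomorphic:
  assumes k: "k \<in> indices m" "l \<in> indices m" "k \<noteq> l" and m: "3 \<le> m"
  shows "\<not> isomorphic_sggi (alt_group (4 * m + 3), gens (family k) m)
    (alt_group (4 * m + 3), gens (family l) m)"
    and "gens (family k) m \<noteq> gens (family l) m"
proof -
  have nth: "gens (family j) m ! i = family j i" if "i < m" "j \<in> indices m" for i j
  proof -
    interpret doubled_system "family j" m "{1..2 * m + 2}" "pt m True" "delta m"
      by (rule doubled_system_delta[OF half_system_family[OF that(2) m]])
    show ?thesis using that(1) by (simp add: gens_def \<tau>_def)
  qed
  obtain i p where i: "Suc i < m" "((family k i \<circ> family k (Suc i)) ^^ p = id) \<noteq>
      ((family l i \<circ> family l (Suc i)) ^^ p = id)"
    using family_distinguished[OF k(1,2) _ m] family_distinguished[OF k(2,1) _ m] k(3)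
    by (metis linorder_neqE_nat)
  have nths: "gens (family j) m ! i = family j i" "gens (family j) m ! Suc i = family j (Suc i)"
    if "j \<in> indices m" for j
    using nth[OF _ that] i(1) by simp_all
  show "gens (family k) m \<noteq> gens (family l) m"
  proof
    assume "gens (family k) m = gens (family l) m"
    then have "family k i = family l i" "family k (Suc i) = family l (Suc i)"
      using nths[OF k(1)] nths[OF k(2)] by simp_all
    then show False using i(2) by simp
  qed
  interpret string_C_group "alt_group (4 * m + 3)" "gens (family k) m"
    by (rule doubled_string_C_group[OF half_system_family[OF k(1) m]])
  show "\<not> isomorphic_sggi (alt_group (4 * m + 3), gens (family k) m)
      (alt_group (4 * m + 3), gens (family l) m)"
  proof
    assume iso: "isomorphic_sggi (alt_group (4 * m + 3), gens (family k) m)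
      (alt_group (4 * m + 3), gens (family l) m)"
    show False
      using isomorphic_sggi_power_eq_id[OF iso generators_closed, of i p] i
      by (simp add: nths[OF k(1)] nths[OF k(2)])
  qed
qed

theorem theorem1p1:
  fixes m n :: nat
  assumes "m > 0" and "n = 4 * m + 3" and "n \<ge> 15"
  shows "\<exists>S :: ((nat \<Rightarrow> nat) monoid \<times> (nat \<Rightarrow> nat) list) set.
    finite S \<and> int (card S) \<ge> \<lfloor>(real n + 9) / 8\<rfloor> \<and>
    (\<forall>(G, \<rho>s) \<in> S. string_C_group G \<rho>s \<and> length \<rho>s = 2 * m \<and> self_dual G \<rho>s \<and> G \<cong> alt_group n) \<and>
    pairwise (\<lambda>x y. \<not> isomorphic_sggi x y) S"
proof -
  \<comment> \<open>This is where \<open>n \<ge> 15\<close> enters: the left half must contain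
    \<open>\<rho> 2\<close>, which is modified in the corner systems and occurs in the comparison by
    fourth powers.\<close>
  have m: "3 \<le> m" using assms by simp
  let ?f = "\<lambda>k. (alt_group n, gens (family k) m)"
  let ?S = "?f ` indices m"
  have inj: "inj_on ?f (indices m)"
    using gens_not_isomorphic(2)[OF _ _ _ m] by (auto simp: inj_on_def)
  have "(real n + 9) / 8 = real (4 * m + 12) / real 8" using assms(2) by simp
  then have "\<lfloor>(real n + 9) / 8\<rfloor> = int ((4 * m + 12) div 8)"
    by (simp only: floor_divide_of_nat_eq)
  also have "(4 * m + 12) div 8 = (m + 3) div 2" by presburger
  finally have "int (card ?S) \<ge> \<lfloor>(real n + 9) / 8\<rfloor>"
    using card_image[OF inj] card_indices(2) by simp
  moreover have "finite ?S" using card_indices(1) by simp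
  moreover have "string_C_group G \<rho>s \<and> length \<rho>s = 2 * m \<and> self_dual G \<rho>s \<and> G \<cong> alt_group n"
    if "(G, \<rho>s) \<in> ?S" for G \<rho>s
    using that doubled_string_C_group[OF half_system_family[OF _ m]] assms(2) iso_refl by auto
  moreover have "pairwise (\<lambda>x y. \<not> isomorphic_sggi x y) ?S"
    using gens_not_isomorphic(1)[OF _ _ _ m] assms(2) by (auto simp: pairwise_def)
  ultimately show ?thesis by (intro exI[of _ ?S]) blast
qed

end
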